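(* Set $\hbar=1$. On the one-mode centered Gaussian manifold with coordinates $(\nu,r,\varphi)$, $\Sigma(\nu,r,\varphi)=\nu G(r,\varphi)$, the mixed-state interior ($\nu>1/2$) Bures metric is singular only in the spectrum-changing radial direction $\nu$ as $\nu\downarrow1/2$: the coefficient $g^{\rm B}_{\nu\nu}$ diverges, whereas the squeezing and phase-rotation coefficients $g^{\rm B}_{rr}$ and $g^{\rm B}_{\varphi\varphi}$ have finite limits. These limits define the intrinsic Bures geometry, equivalently the Fubini--Study geometry, tangent to the pure Gaussian-state manifold; that is, they are the components, in the coordinates $(r,\varphi)$, of the Fubini--Study metric restricted to the family of pure centered Gaussian states with covariance $\frac12G(r,\varphi)$.
   Context: $G(r,\varphi)=R(\varphi)\operatorname{diag}(e^{2r},e^{-2r})R(\varphi)^{\mathsf T}$ with $R(\varphi)$ the $2\times2$ rotation by angle $\varphi$ and $r,\varphi\in\mathbb R$. For $\nu>1/2$ the Bures metric is $g^{\rm B}_{ij}=\frac14F_{ij}$, with $F_{ij}=\frac12\operatorname{Tr}(\mathfrak G_i\partial_j\Sigma)$ and $\mathfrak G_i$ the real symmetric solution of $\Sigma\mathfrak G_i\Sigma+\frac14\Omega\mathfrak G_i\Omega=\partial_i\Sigma$, $\Omega=\begin{pmatrix}0&1\\-1&0\end{pmatrix}$. The covariance of a centered state is $\Sigma_{ab}=\frac12\langle\{\hat R_a,\hat R_b\}\rangle$ with $\hat R=(\hat x,\hat p)$, $[\hat x,\hat p]=i$, so the vacuum has covariance $\frac12\mathbb 1_2$; covariances with $\nu=1/2$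 correspond to pure Gaussian states, namely squeezed and rotated vacua. On pure states, the convention "Bures metric $=\frac14\times$ SLD quantum Fisher information" gives the Fubini--Study metric in the normalization $\langle d\psi|d\psi\rangle-|\langle\psi|d\psi\rangle|^2$ for normalized $|\psi\rangle$. *)

theory Defs
  imports "HOL-Analysis.Analysis"
begin

definition rot :: "real \<Rightarrow> real^2^2" where
  "rot \<phi> = vector [vector [cos \<phi>, - sin \<phi>], vector [sin \<phi>, cos \<phi>]]"

definition squeeze :: "real \<Rightarrow> real \<Rightarrow> real^2^2" where
  "squeeze r \<phi> =
     rot \<phi> ** vector [vector [exp (2 * r), 0], vector [0, exp (- 2 * r)]] ** transpose (rot \<phi>)"

definition covar :: "real \<Rightarrow> real \<Rightarrow> real \<Rightarrow> real^2^2" where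
  "covar \<nu> r \<phi> = \<nu> *\<^sub>R squeeze r \<phi>"

definition Omega :: "real^2^2" where
  "Omega = vector [vector [0, 1], vector [- 1, 0]]"

text \<open>The coordinates \<open>\<nu>\<close>, \<open>r\<close>, \<open>\<phi>\<close> on the manifold of centered Gaussian states.\<close>

datatype coord = Nu | Sq | Ph

fun d_covar :: "coord \<Rightarrow> real \<Rightarrow> real \<Rightarrow> real \<Rightarrow> real^2^2" where
  "d_covar Nu \<nu> r \<phi> = vector_derivative (\<lambda>t. covar t r \<phi>) (at \<nu>)"
| "d_covar Sq \<nu> r \<phi> = vector_derivative (\<lambda>t. covar \<nu> t \<phi>) (at r)"
| "d_covar Ph \<nu> r \<phi> = vector_derivative (\<lambda>t. covar \<nu> r t) (at \<phi>)"

definition sld_eq :: "real^2^2 \<Rightarrow> real^2^2 \<Rightarrow> real^2^2 \<Rightarrow> bool" where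
  "sld_eq S Y X \<longleftrightarrow> transpose X = X \<and>
     S ** X ** S + (1/4) *\<^sub>R (Omega ** X ** Omega) = Y"

text \<open>The following justifies the definite description in \<open>sld\<close> below: \<open>covar \<nu> r \<phi>\<close> has
  determinant \<open>\<nu>\<^sup>2\<close>, so that the equation is uniquely solvable for \<open>\<nu> > 1/2\<close>.\<close>

lemma sld_eq_ex1:
  fixes S Y :: "real^2^2"
  assumes S: "transpose S = S" and Y: "transpose Y = Y" and d: "det S > 1/4"
  shows "\<exists>!X. sld_eq S Y X"
proof -
  have sym: "A$2$1 = A$1$2" if "transpose A = A" for A :: "real^2^2"
  proof -
    have "transpose A $ 1 $ 2 = A $ 2 $ 1" by (simp add: transpose_def)
    with that show ?thesis by simp
  qed
  obtain p q s where pqs: "S$1$1 = p" "S$1$2 = q" "S$2$1 = q" "S$2$2 = s"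
    using sym[OF S] by metis
  obtain e f g where efg: "Y$1$1 = e" "Y$1$2 = f" "Y$2$1 = f" "Y$2$2 = g"
    using sym[OF Y] by metis
  define k where "k = p * s - q * q + 1/4"
  define m where "m = p * s - q * q - 1/4"
  have m0: "m \<noteq> 0" and k0: "k \<noteq> 0"
    using d by (auto simp: det_2 pqs k_def m_def)
  define t where "t = (s * e - 2 * q * f + p * g) / m"
  have comp: "sld_eq S Y X \<longleftrightarrow> X$2$1 = X$1$2 \<and>
      (p * X$1$1 + 2 * q * X$1$2 + s * X$2$2) * p - k * X$2$2 = e \<and>
      (p * X$1$1 + 2 * q * X$1$2 + s * X$2$2) * q + k * X$1$2 = f \<and>
      (p * X$1$1 + 2 * q * X$1$2 + s * X$2$2) * s - k * X$1$1 = g" for X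
  proof -
    have tr: "transpose X = X \<longleftrightarrow> X$2$1 = X$1$2"
    proof
      assume "X$2$1 = X$1$2"
      then show "transpose X = X"
        unfolding vec_eq_iff forall_2 transpose_def by simp
    qed (rule sym)
    have "S ** X ** S + (1/4) *\<^sub>R (Omega ** X ** Omega) = Y \<longleftrightarrow>
      (p * X$1$1 + 2 * q * X$1$2 + s * X$2$2) * p - k * X$2$2 = e \<and>
      (p * X$1$1 + 2 * q * X$1$2 + s * X$2$2) * q + k * X$1$2 = f \<and>
      (p * X$1$1 + 2 * q * X$1$2 + s * X$2$2) * s - k * X$1$1 = g" if x: "X$2$1 = X$1$2"
    proof -
      let ?M = "S ** X ** S + (1/4) *\<^sub>R (Omega ** X ** Omega)"
      let ?t = "p * X$1$1 + 2 * q * X$1$2 + s * X$2$2"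
      have "?M$1$1 = ?t * p - k * X$2$2" "?M$1$2 = ?t * q + k * X$1$2"
        "?M$2$1 = ?t * q + k * X$1$2" "?M$2$2 = ?t * s - k * X$1$1"
        by (simp_all add: matrix_matrix_mult_def sum_2 Omega_def pqs x k_def)
          (simp_all add: algebra_simps)
      then show ?thesis
        by (simp only: vec_eq_iff forall_2 efg) blast
    qed
    then show ?thesis unfolding sld_eq_def tr by blast
  qed
  have sol: "(p * x + 2 * q * y + s * z) * p - k * z = e \<and>
      (p * x + 2 * q * y + s * z) * q + k * y = f \<and>
      (p * x + 2 * q * y + s * z) * s - k * x = g \<longleftrightarrow>
      x = (t * s - g) / k \<and> y = (f - t * q) / k \<and> z = (t * p - e) / k" (is "?L \<longleftrightarrow> ?R") for x y z
  proof
    assume L: ?L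
    define w where "w = p * x + 2 * q * y + s * z"
    have L': "e = w * p - k * z" "f = w * q + k * y" "g = w * s - k * x"
      using L by (auto simp: w_def)
    have "s * e - 2 * q * f + p * g = 2 * (p * s - q * q) * w - k * w"
      unfolding L' by (simp add: w_def algebra_simps)
    also have "\<dots> = m * w" by (simp add: k_def m_def algebra_simps)
    finally have "t = w" using m0 by (simp add: t_def)
    then show ?R using k0 by (simp add: L')
  next
    assume R: ?R
    have x: "k * x = t * s - g" and y: "k * y = f - t * q" and z: "k * z = t * p - e"
      using R k0 by auto
    have mt: "m * t = s * e - 2 * q * f + p * g"
      using m0 by (simp add: t_def)
    have "k * (p * x + 2 * q * y + s * z) = p * (k * x) + 2 * q * (k * y) + s * (k * z)"
      by (simp add: algebra_simps)
    also have "\<dots> = 2 * (p * s - q * q) * t - m * t"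
      unfolding x y z mt by (simp add: algebra_simps)
    also have "\<dots> = k * t" by (simp add: k_def m_def algebra_simps)
    finally have "p * x + 2 * q * y + s * z = t" using k0 by simp
    then show ?L using x y z by (simp add: algebra_simps)
  qed
  have "sld_eq S Y X \<longleftrightarrow> X = vector [vector [(t * s - g) / k, (f - t * q) / k],
      vector [(f - t * q) / k, (t * p - e) / k]]" for X
    unfolding comp sol by (auto simp: vec_eq_iff forall_2)
  then show ?thesis by simp
qed

definition sld :: "coord \<Rightarrow> real \<Rightarrow> real \<Rightarrow> real \<Rightarrow> real^2^2" where
  "sld i \<nu> r \<phi> = (THE X. sld_eq (covar \<nu> r \<phi>) (d_covar i \<nu> r \<phi>) X)"

definition qfi :: "coord \<Rightarrow> coord \<Rightarrow> real \<Rightarrow> real \<Rightarrow> real \<Rightarrow> real" where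
  "qfi i j \<nu> r \<phi> = 1/2 * trace (sld i \<nu> r \<phi> ** d_covar j \<nu> r \<phi>)"

definition bures :: "coord \<Rightarrow> coord \<Rightarrow> real \<Rightarrow> real \<Rightarrow> real \<Rightarrow> real" where
  "bures i j \<nu> r \<phi> = 1/4 * qfi i j \<nu> r \<phi>"

text \<open>Pure states are represented by wave functions in the position representation on
  \<open>L\<^sup>2(\<real>)\<close>; the inner product is linear in the second argument.\<close>

definition L2 :: "(real \<Rightarrow> complex) \<Rightarrow> bool" where
  "L2 f \<longleftrightarrow> f \<in> borel_measurable lborel \<and> integrable lborel (\<lambda>x. (cmod (f x))\<^sup>2)"

definition l2_inner :: "(real \<Rightarrow> complex) \<Rightarrow> (real \<Rightarrow> complex) \<Rightarrow> complex" where
  "l2_inner f g = (LINT x|lborel. cnj (f x) * g x)"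

definition l2_norm :: "(real \<Rightarrow> complex) \<Rightarrow> real" where
  "l2_norm f = sqrt (LINT x|lborel. (cmod (f x))\<^sup>2)"

definition position :: "(real \<Rightarrow> complex) \<Rightarrow> real \<Rightarrow> complex" where
  "position f = (\<lambda>x. of_real x * f x)"

definition momentum :: "(real \<Rightarrow> complex) \<Rightarrow> real \<Rightarrow> complex" where
  "momentum f = (\<lambda>x. - \<i> * vector_derivative f (at x))"

definition quad :: "2 \<Rightarrow> (real \<Rightarrow> complex) \<Rightarrow> real \<Rightarrow> complex" where
  "quad a = (if a = 1 then position else momentum)"

definition centered :: "(real \<Rightarrow> complex) \<Rightarrow> bool" where
  "centered \<psi> \<longleftrightarrow> (\<forall>a. l2_inner \<psi> (quad a \<psi>) = 0)"

text \<open>The second moments of the symmetrised products are real, so nothing is lost in \<open>Re\<close>.\<close>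

definition state_covar :: "(real \<Rightarrow> complex) \<Rightarrow> real^2^2" where
  "state_covar \<psi> = (\<chi> a b.
     1/2 * Re (l2_inner \<psi> (quad a (quad b \<psi>)) + l2_inner \<psi> (quad b (quad a \<psi>))))"

definition gaussian_wf :: "(real \<Rightarrow> complex) \<Rightarrow> bool" where
  "gaussian_wf \<psi> \<longleftrightarrow>
     (\<exists>a b c. Re a > 0 \<and> \<psi> = (\<lambda>x. exp (- a * (of_real x)\<^sup>2 + b * of_real x + c)))"

definition pure_gaussian :: "real^2^2 \<Rightarrow> (real \<Rightarrow> complex) \<Rightarrow> bool" where
  "pure_gaussian S \<psi> \<longleftrightarrow>
     gaussian_wf \<psi> \<and> l2_norm \<psi> = 1 \<and> centered \<psi> \<and> state_covar \<psi> = S"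

text \<open>A lift assigns to \<open>(r, \<phi>)\<close> a representing unit vector of the pure centered Gaussian state
  with covariance \<open>1/2 G(r, \<phi>)\<close>. No choice of phase is fixed.\<close>

definition gaussian_lift :: "(real \<Rightarrow> real \<Rightarrow> real \<Rightarrow> complex) \<Rightarrow> bool" where
  "gaussian_lift \<psi> \<longleftrightarrow> (\<forall>r \<phi>. pure_gaussian ((1/2) *\<^sub>R squeeze r \<phi>) (\<psi> r \<phi>))"

text \<open>Frechet differentiability in \<open>L\<^sup>2(\<real>)\<close> at \<open>(r, \<phi>)\<close>, with partial derivatives \<open>u\<close> and \<open>v\<close>.\<close>

definition has_l2_partials ::
  "(real \<Rightarrow> real \<Rightarrow> real \<Rightarrow> complex) \<Rightarrow> (real \<Rightarrow> complex) \<Rightarrow> (real \<Rightarrow> complex) \<Rightarrow> real \<Rightarrow> real \<Rightarrow> bool"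
where
  "has_l2_partials \<psi> u v r \<phi> \<longleftrightarrow> L2 u \<and> L2 v \<and>
     ((\<lambda>h. l2_norm (\<lambda>x. \<psi> (r + fst h) (\<phi> + snd h) x - \<psi> r \<phi> x
              - of_real (fst h) * u x - of_real (snd h) * v x) / norm h) \<longlongrightarrow> 0) (at 0)"

text \<open>The bilinear form obtained by polarisation from
  \<open>\<langle>d\<psi>|d\<psi>\<rangle> - |\<langle>\<psi>|d\<psi>\<rangle>|\<^sup>2\<close> at the unit vector \<open>\<psi>\<close>.\<close>

definition fubini_study ::
  "(real \<Rightarrow> complex) \<Rightarrow> (real \<Rightarrow> complex) \<Rightarrow> (real \<Rightarrow> complex) \<Rightarrow> real" where
  "fubini_study \<psi> u v = Re (l2_inner u v - l2_inner u \<psi> * l2_inner \<psi> v)"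

end

theory Submission
  imports Defs "HOL-Probability.Distributions"
begin

text \<open>Since \<open>det G = 1\<close>, the tangent vectors \<open>\<partial>\<^sub>r G\<close> and \<open>\<partial>\<^sub>\<phi> G\<close> are trace-free relative to \<open>G\<close>,
  and on such matrices the equation for the symmetric logarithmic derivative acts with the factor
  \<open>\<nu>\<^sup>2 + 1/4\<close>, whereas the direction \<open>\<partial>\<^sub>\<nu> \<Sigma> = G\<close> sees the factor \<open>\<nu>\<^sup>2 - 1/4\<close>, which vanishes at
  \<open>\<nu> = 1/2\<close>. On the pure side, a centered Gaussian \<open>exp (- a x\<^sup>2 + c)\<close> of unit norm has Fubini--Study
  metric \<open>Re (cnj da da) / (8 (Re a)\<^sup>2)\<close>, because the variance of \<open>x\<^sup>2\<close> is \<open>1 / (8 (Re a)\<^sup>2)\<close>. For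
  \<open>a = (1 - \<i> G\<^sub>1\<^sub>2) / (2 G\<^sub>1\<^sub>1)\<close> this is the limit of the Bures metric. An arbitrary lift differs
  from this one by a phase depending on \<open>(r, \<phi>)\<close> in an unknown way, so the two are compared through
  the phase-independent expansion \<open>1 - |\<langle>\<psi>\<^sub>0|\<psi>\<^sub>\<epsilon>\<rangle>|\<^sup>2 = \<epsilon>\<^sup>2 g(w, w) + o(\<epsilon>\<^sup>2)\<close>.\<close>

section \<open>The Bures metric\<close>

text \<open>Carrying symmetric matrices by their three entries turns the matrix identities below
  into polynomial identities that \<open>algebra\<close> can settle.\<close>

definition sym2 :: "real \<Rightarrow> real \<Rightarrow> real \<Rightarrow> real^2^2" where
  "sym2 x y z = vector [vector [x, y], vector [y, z]]"

lemma sym2_nth [simp]: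
  "sym2 x y z $ 1 $ 1 = x" "sym2 x y z $ 1 $ 2 = y" "sym2 x y z $ 2 $ 1 = y" "sym2 x y z $ 2 $ 2 = z"
  by (simp_all add: sym2_def)

lemma mat2_eq_iff:
  fixes A B :: "real^2^2"
  shows "A = B \<longleftrightarrow> A$1$1 = B$1$1 \<and> A$1$2 = B$1$2 \<and> A$2$1 = B$2$1 \<and> A$2$2 = B$2$2"
  by (auto simp: vec_eq_iff forall_2)

lemma transpose_sym2 [simp]: "transpose (sym2 x y z) = sym2 x y z"
  by (simp add: mat2_eq_iff transpose_def)

lemma scaleR_sym2 [simp]: "c *\<^sub>R sym2 x y z = sym2 (c * x) (c * y) (c * z)"
  by (simp add: mat2_eq_iff)

lemma det_sym2: "det (sym2 x y z) = x * z - y\<^sup>2"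
  by (simp add: det_2 power2_eq_square)

lemma trace_sym2_mult: "trace (sym2 a b c ** sym2 x y z) = a * x + 2 * b * y + c * z"
  by (simp add: trace_def matrix_matrix_mult_def sum_2)

text \<open>For symmetric 2x2 matrices, Cayley-Hamilton gives
  \<open>S X S = tr(S X) S - det S adj X\<close>, and \<open>Omega X Omega = - adj X\<close>. The
  equation therefore reads \<open>Y = tr(S X) S - (det S + 1/4) adj X\<close>, which only involves
  one trace and one determinant.\<close>

lemma sld_eq_sym2:
  "sld_eq (sym2 x y z) (sym2 e f g) (sym2 a b c) \<longleftrightarrow>
     e = (x * a + 2 * y * b + z * c) * x - (x * z - y\<^sup>2 + 1/4) * c \<and>
     f = (x * a + 2 * y * b + z * c) * y + (x * z - y\<^sup>2 + 1/4) * b \<and>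
     g = (x * a + 2 * y * b + z * c) * z - (x * z - y\<^sup>2 + 1/4) * a"
  unfolding sld_eq_def
  by (simp add: mat2_eq_iff matrix_matrix_mult_def sum_2 Omega_def)
    (auto simp: algebra_simps power2_eq_square)

lemma sld_unique:
  assumes "sld_eq (sym2 x y z) (sym2 e f g) X" "x * z - y\<^sup>2 > 1/4"
  shows "(THE X. sld_eq (sym2 x y z) (sym2 e f g) X) = X"
  using sld_eq_ex1[of "sym2 x y z" "sym2 e f g"] assms by (auto simp: det_sym2 intro: the1_equality)

lemma has_vector_derivative_sym2 [derivative_intros]:
  assumes "(x has_real_derivative dx) (at t)" "(y has_real_derivative dy) (at t)"
    "(z has_real_derivative dz) (at t)"
  shows "((\<lambda>t. sym2 (x t) (y t) (z t)) has_vector_derivative sym2 dx dy dz) (at t)"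
proof -
  have split: "sym2 a b c = a *\<^sub>R sym2 1 0 0 + b *\<^sub>R sym2 0 1 0 + c *\<^sub>R sym2 0 0 1" for a b c
    by (simp add: mat2_eq_iff)
  have "((\<lambda>t. x t *\<^sub>R sym2 1 0 0 + y t *\<^sub>R sym2 0 1 0 + z t *\<^sub>R sym2 0 0 1) has_vector_derivative
      dx *\<^sub>R sym2 1 0 0 + dy *\<^sub>R sym2 0 1 0 + dz *\<^sub>R sym2 0 0 1) (at t)"
    using assms by (auto intro!: derivative_eq_intros simp del: scaleR_sym2)
  then show ?thesis by (simp only: split[symmetric])
qed

section \<open>Entries of the squeezing matrix G and their derivatives\<close>

definition Gxx :: "real \<Rightarrow> real \<Rightarrow> real" where
  "Gxx r \<phi> = (cos \<phi>)\<^sup>2 * exp (2 * r) + (sin \<phi>)\<^sup>2 * exp (- 2 * r)"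

definition Gxp :: "real \<Rightarrow> real \<Rightarrow> real" where
  "Gxp r \<phi> = cos \<phi> * sin \<phi> * (exp (2 * r) - exp (- 2 * r))"

definition Gpp :: "real \<Rightarrow> real \<Rightarrow> real" where
  "Gpp r \<phi> = (sin \<phi>)\<^sup>2 * exp (2 * r) + (cos \<phi>)\<^sup>2 * exp (- 2 * r)"

lemma squeeze_eq: "squeeze r \<phi> = sym2 (Gxx r \<phi>) (Gxp r \<phi>) (Gpp r \<phi>)"
  by (simp add: mat2_eq_iff squeeze_def rot_def matrix_matrix_mult_def sum_2 transpose_def
      Gxx_def Gxp_def Gpp_def algebra_simps power2_eq_square)

lemma covar_eq: "covar \<nu> r \<phi> = sym2 (\<nu> * Gxx r \<phi>) (\<nu> * Gxp r \<phi>) (\<nu> * Gpp r \<phi>)"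
  by (simp add: covar_def squeeze_eq)

lemma Gxx_pos [simp]: "Gxx r \<phi> > 0"
proof (cases "cos \<phi> = 0")
  case True
  then have "(sin \<phi>)\<^sup>2 = 1" using sin_cos_squared_add[of \<phi>] by simp
  with True show ?thesis by (simp add: Gxx_def)
next
  case False
  then show ?thesis unfolding Gxx_def by (intro add_pos_nonneg) simp_all
qed

lemma Gxx_nonzero [simp]: "Gxx r \<phi> \<noteq> 0"
  using Gxx_pos[of r \<phi>] by (metis less_irrefl)

lemma Gdet: "Gxx r \<phi> * Gpp r \<phi> - (Gxp r \<phi>)\<^sup>2 = 1"
proof -
  have e: "exp (2 * r) * exp (- 2 * r) = 1" by (simp flip: exp_add)
  have cs: "(sin \<phi>)\<^sup>2 = 1 - (cos \<phi>)\<^sup>2" by (simp add: sin_squared_eq)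
  have "Gxx r \<phi> * Gpp r \<phi> - (Gxp r \<phi>)\<^sup>2
     = ((cos \<phi>)\<^sup>2 + (sin \<phi>)\<^sup>2)\<^sup>2 * (exp (2 * r) * exp (- 2 * r))"
    unfolding Gxx_def Gxp_def Gpp_def by algebra
  then show ?thesis unfolding e by simp
qed

text \<open>In the \<open>Ph\<close> direction the three derivatives are the entries of the
  commutator of the rotation generator with G, which is why they are linear in the entries of G. The
  \<open>Nu\<close> entries vanish because G does not depend on \<nu>.\<close>

fun dGxx :: "coord \<Rightarrow> real \<Rightarrow> real \<Rightarrow> real" where
  "dGxx Nu r \<phi> = 0"
| "dGxx Sq r \<phi> = 2 * ((cos \<phi>)\<^sup>2 * exp (2 * r) - (sin \<phi>)\<^sup>2 * exp (- 2 * r))"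
| "dGxx Ph r \<phi> = - 2 * Gxp r \<phi>"

fun dGxp :: "coord \<Rightarrow> real \<Rightarrow> real \<Rightarrow> real" where
  "dGxp Nu r \<phi> = 0"
| "dGxp Sq r \<phi> = 2 * cos \<phi> * sin \<phi> * (exp (2 * r) + exp (- 2 * r))"
| "dGxp Ph r \<phi> = Gxx r \<phi> - Gpp r \<phi>"

fun dGpp :: "coord \<Rightarrow> real \<Rightarrow> real \<Rightarrow> real" where
  "dGpp Nu r \<phi> = 0"
| "dGpp Sq r \<phi> = 2 * ((sin \<phi>)\<^sup>2 * exp (2 * r) - (cos \<phi>)\<^sup>2 * exp (- 2 * r))"
| "dGpp Ph r \<phi> = 2 * Gxp r \<phi>"

text \<open>This is \<open>Gdet\<close> differentiated: the determinant stays 1, so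
  \<open>tr(adj G dG) = 0\<close>. It makes the trace term of the equation in
  \<open>sld_eq_sym2\<close> disappear for tangent directions.\<close>

lemma dGdet:
  "dGxx i r \<phi> * Gpp r \<phi> + Gxx r \<phi> * dGpp i r \<phi> = 2 * Gxp r \<phi> * dGxp i r \<phi>"
proof (cases i)
  case Sq
  have "dGxx Sq r \<phi> * Gpp r \<phi> + Gxx r \<phi> * dGpp Sq r \<phi> = 2 * Gxp r \<phi> * dGxp Sq r \<phi>"
    unfolding dGxx.simps dGxp.simps dGpp.simps Gxx_def Gxp_def Gpp_def by algebra
  with Sq show ?thesis by simp
qed (simp_all add: algebra_simps)

lemma G_has_derivative:
  "((\<lambda>h. Gxx (fst h) (snd h)) has_derivative
      (\<lambda>h. fst h * dGxx Sq r \<phi> + snd h * dGxx Ph r \<phi>)) (at (r, \<phi>))"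
  "((\<lambda>h. Gxp (fst h) (snd h)) has_derivative
      (\<lambda>h. fst h * dGxp Sq r \<phi> + snd h * dGxp Ph r \<phi>)) (at (r, \<phi>))"
  "((\<lambda>h. Gpp (fst h) (snd h)) has_derivative
      (\<lambda>h. fst h * dGpp Sq r \<phi> + snd h * dGpp Ph r \<phi>)) (at (r, \<phi>))"
  unfolding Gxx_def Gxp_def Gpp_def
  by (auto intro!: derivative_eq_intros ext
      simp: Gxx_def Gxp_def Gpp_def algebra_simps power2_eq_square)

section \<open>Logarithmic derivatives and metric coefficients for \<nu> > 1/2\<close>

lemma d_covar_Nu: "d_covar Nu \<nu> r \<phi> = sym2 (Gxx r \<phi>) (Gxp r \<phi>) (Gpp r \<phi>)"
  unfolding d_covar.simps covar_eq
  by (rule vector_derivative_at) (auto intro!: derivative_eq_intros)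

lemma d_covar_tangent:
  assumes "i \<noteq> Nu"
  shows "d_covar i \<nu> r \<phi> = sym2 (\<nu> * dGxx i r \<phi>) (\<nu> * dGxp i r \<phi>) (\<nu> * dGpp i r \<phi>)"
proof (cases i)
  case Sq
  have "((\<lambda>t. covar \<nu> t \<phi>) has_vector_derivative
      sym2 (\<nu> * dGxx Sq r \<phi>) (\<nu> * dGxp Sq r \<phi>) (\<nu> * dGpp Sq r \<phi>)) (at r)"
    unfolding covar_eq Gxx_def Gxp_def Gpp_def
    by (rule has_vector_derivative_sym2) (auto intro!: derivative_eq_intros simp: algebra_simps)
  with Sq show ?thesis by (simp add: vector_derivative_at)
next
  case Ph
  have "((\<lambda>t. covar \<nu> r t) has_vector_derivative
      sym2 (\<nu> * dGxx Ph r \<phi>) (\<nu> * dGxp Ph r \<phi>) (\<nu> * dGpp Ph r \<phi>)) (at \<phi>)"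
    unfolding covar_eq dGxx.simps dGxp.simps dGpp.simps Gxx_def Gxp_def Gpp_def
    by (rule has_vector_derivative_sym2)
      (auto intro!: derivative_eq_intros simp: algebra_simps power2_eq_square)
  with Ph show ?thesis by (simp add: vector_derivative_at)
qed (use assms in simp)

lemma Gdet_scaled: "\<nu> * Gxx r \<phi> * (\<nu> * Gpp r \<phi>) - (\<nu> * Gxp r \<phi>)\<^sup>2 = \<nu>\<^sup>2"
proof -
  have "\<nu> * Gxx r \<phi> * (\<nu> * Gpp r \<phi>) - (\<nu> * Gxp r \<phi>)\<^sup>2 = \<nu>\<^sup>2 * (Gxx r \<phi> * Gpp r \<phi> - (Gxp r \<phi>)\<^sup>2)"
    by algebra
  then show ?thesis by (simp add: Gdet)
qed

lemma half_less_square: "(1/4 :: real) < \<nu>\<^sup>2" if "\<nu> > 1/2"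
proof -
  have "(1/2 :: real)\<^sup>2 < \<nu>\<^sup>2" using that by (intro power_strict_mono) auto
  then show ?thesis by (simp add: power2_eq_square)
qed

text \<open>The ansatz is \<open>X = m adj G\<close>. Then
  \<open>tr(\<Sigma> X) = 2 \<nu> m\<close>, and the equation becomes
  \<open>m (2 \<nu>^2 - (\<nu>^2 + 1/4)) G = G\<close>. The difference of the two contributions is
  the factor \<open>\<nu>^2 - 1/4\<close>, the source of the divergence.\<close>

lemma sld_Nu:
  assumes "\<nu> > 1/2"
  shows "sld Nu \<nu> r \<phi> = (1 / (\<nu>\<^sup>2 - 1/4)) *\<^sub>R sym2 (Gpp r \<phi>) (- Gxp r \<phi>) (Gxx r \<phi>)"
  unfolding sld_def d_covar_Nu covar_eq
proof (rule sld_unique)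
  define m where "m = 1 / (\<nu>\<^sup>2 - 1/4)"
  have m: "m * (\<nu>\<^sup>2 - 1/4) = 1" using half_less_square[OF assms] by (simp add: m_def)
  let ?t = "\<nu> * Gxx r \<phi> * (m * Gpp r \<phi>) + 2 * (\<nu> * Gxp r \<phi>) * (m * - Gxp r \<phi>)
     + \<nu> * Gpp r \<phi> * (m * Gxx r \<phi>)"
  have t: "?t = 2 * \<nu> * m"
    using Gdet[of r \<phi>] by algebra
  show "sld_eq (sym2 (\<nu> * Gxx r \<phi>) (\<nu> * Gxp r \<phi>) (\<nu> * Gpp r \<phi>)) (sym2 (Gxx r \<phi>) (Gxp r \<phi>) (Gpp r \<phi>))
     ((1 / (\<nu>\<^sup>2 - 1/4)) *\<^sub>R sym2 (Gpp r \<phi>) (- Gxp r \<phi>) (Gxx r \<phi>))"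
    unfolding m_def[symmetric] scaleR_sym2 sld_eq_sym2 t Gdet_scaled
    using m by algebra
qed (use half_less_square[OF \<open>\<nu> > 1/2\<close>] in \<open>simp add: Gdet_scaled\<close>)

text \<open>The ansatz is \<open>X = - k adj dG\<close>. Its trace against the covariance vanishes
  by \<open>dGdet\<close>, so only the adjugate term survives, and
  \<open>k (\<nu>^2 + 1/4) = \<nu>\<close> fixes the constant.\<close>

lemma sld_tangent:
  assumes "\<nu> > 1/2" "i \<noteq> Nu"
  shows "sld i \<nu> r \<phi> = (\<nu> / (\<nu>\<^sup>2 + 1/4)) *\<^sub>R sym2 (- dGpp i r \<phi>) (dGxp i r \<phi>) (- dGxx i r \<phi>)"
  unfolding sld_def d_covar_tangent[OF assms(2)] covar_eq
proof (rule sld_unique)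
  define k where "k = \<nu> / (\<nu>\<^sup>2 + 1/4)"
  have "\<nu>\<^sup>2 + 1/4 \<noteq> 0" using half_less_square[OF assms(1)] by simp
  then have k: "(\<nu>\<^sup>2 + 1/4) * (k * d) = \<nu> * d" for d by (simp add: k_def)
  let ?t = "\<nu> * Gxx r \<phi> * (k * - dGpp i r \<phi>) + 2 * (\<nu> * Gxp r \<phi>) * (k * dGxp i r \<phi>)
     + \<nu> * Gpp r \<phi> * (k * - dGxx i r \<phi>)"
  have t: "?t = 0"
    using dGdet[of i r \<phi>] by algebra
  show "sld_eq (sym2 (\<nu> * Gxx r \<phi>) (\<nu> * Gxp r \<phi>) (\<nu> * Gpp r \<phi>))
     (sym2 (\<nu> * dGxx i r \<phi>) (\<nu> * dGxp i r \<phi>) (\<nu> * dGpp i r \<phi>))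
     ((\<nu> / (\<nu>\<^sup>2 + 1/4)) *\<^sub>R sym2 (- dGpp i r \<phi>) (dGxp i r \<phi>) (- dGxx i r \<phi>))"
    unfolding k_def[symmetric] scaleR_sym2 sld_eq_sym2 t Gdet_scaled k by simp
qed (use half_less_square[OF \<open>\<nu> > 1/2\<close>] in \<open>simp add: Gdet_scaled\<close>)

lemma bures_Nu_Nu:
  assumes "\<nu> > 1/2"
  shows "bures Nu Nu \<nu> r \<phi> = 1 / (4 * (\<nu>\<^sup>2 - 1/4))"
proof -
  have t: "trace (sld Nu \<nu> r \<phi> ** d_covar Nu \<nu> r \<phi>) = 2 * (1 / (\<nu>\<^sup>2 - 1/4))"
    unfolding sld_Nu[OF assms] d_covar_Nu scaleR_sym2 trace_sym2_mult
    using Gdet[of r \<phi>] by algebra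
  show ?thesis unfolding bures_def qfi_def t by simp
qed

text \<open>The radial and tangent directions are orthogonal because both traces are multiples of
  \<open>tr(adj G dG) = 0\<close>.\<close>

lemma bures_Nu_tangent:
  assumes "\<nu> > 1/2" "i \<noteq> Nu"
  shows "bures Nu i \<nu> r \<phi> = 0" "bures i Nu \<nu> r \<phi> = 0"
proof -
  have "trace (sld Nu \<nu> r \<phi> ** d_covar i \<nu> r \<phi>) = 0"
    unfolding sld_Nu[OF assms(1)] d_covar_tangent[OF assms(2)] scaleR_sym2 trace_sym2_mult
    using dGdet[of i r \<phi>] by algebra
  then show "bures Nu i \<nu> r \<phi> = 0" by (simp add: bures_def qfi_def)
  have "trace (sld i \<nu> r \<phi> ** d_covar Nu \<nu> r \<phi>) = 0"
    unfolding sld_tangent[OF assms] d_covar_Nu scaleR_sym2 trace_sym2_mult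
    using dGdet[of i r \<phi>] by algebra
  then show "bures i Nu \<nu> r \<phi> = 0" by (simp add: bures_def qfi_def)
qed

text \<open>This is \<open>- tr(adj(dG_i) dG_j) / 16\<close>. Since \<open>tr(adj G dG) = 0\<close>
  and G has determinant 1, it equals \<open>tr(G^-1 dG_i G^-1 dG_j) / 16\<close>. It is normalised
  so that the prefactor in \<open>bures_tangent\<close> becomes 1 at \<nu> = 1/2.\<close>

definition bures_limit :: "coord \<Rightarrow> coord \<Rightarrow> real \<Rightarrow> real \<Rightarrow> real" where
  "bures_limit i j r \<phi> = (2 * dGxp i r \<phi> * dGxp j r \<phi>
     - dGxx i r \<phi> * dGpp j r \<phi> - dGpp i r \<phi> * dGxx j r \<phi>) / 16"

lemma bures_tangent:
  assumes "\<nu> > 1/2" "i \<noteq> Nu" "j \<noteq> Nu"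
  shows "bures i j \<nu> r \<phi> = 2 * \<nu>\<^sup>2 / (\<nu>\<^sup>2 + 1/4) * bures_limit i j r \<phi>"
proof -
  define k where "k = \<nu> / (\<nu>\<^sup>2 + 1/4)"
  have k: "2 * \<nu>\<^sup>2 / (\<nu>\<^sup>2 + 1/4) = 2 * \<nu> * k" by (simp add: k_def power2_eq_square)
  show ?thesis
    unfolding bures_def qfi_def sld_tangent[OF assms(1,2)] d_covar_tangent[OF assms(3)]
      scaleR_sym2 trace_sym2_mult bures_limit_def k k_def[symmetric]
    by (simp add: algebra_simps)
qed

section \<open>One-sided limits at the pure-state boundary\<close>

lemma eventually_half_less: "eventually (\<lambda>\<nu>. \<nu> > 1/2) (at_right (1/2 :: real))"
  by (rule eventually_at_right_less)

lemma filterlim_bures_Nu_Nu: "filterlim (\<lambda>\<nu>. bures Nu Nu \<nu> r \<phi>) at_top (at_right (1/2))"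
proof -
  have "((\<lambda>\<nu>::real. 4 * (\<nu>\<^sup>2 - 1/4)) \<longlongrightarrow> 4 * ((1/2)\<^sup>2 - 1/4)) (at_right (1/2))"
    by (intro tendsto_intros)
  then have "((\<lambda>\<nu>::real. 4 * (\<nu>\<^sup>2 - 1/4)) \<longlongrightarrow> 0) (at_right (1/2))"
    by (simp add: power2_eq_square)
  moreover have "eventually (\<lambda>\<nu>::real. 4 * (\<nu>\<^sup>2 - 1/4) > 0) (at_right (1/2))"
    by (rule eventually_mono[OF eventually_half_less]) (simp only: half_less_square
        zero_less_mult_iff diff_gt_0_iff_gt, simp)
  ultimately have "filterlim (\<lambda>\<nu>::real. 1 / (4 * (\<nu>\<^sup>2 - 1/4))) at_top (at_right (1/2))"
    unfolding divide_inverse mult_1 by (rule filterlim_inverse_at_top)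
  then show ?thesis
    by (rule filterlim_mono_eventually)
      (auto intro: eventually_mono[OF eventually_half_less] simp: bures_Nu_Nu)
qed

lemma tendsto_bures_tangent:
  assumes "i \<noteq> Nu" "j \<noteq> Nu"
  shows "((\<lambda>\<nu>. bures i j \<nu> r \<phi>) \<longlongrightarrow> bures_limit i j r \<phi>) (at_right (1/2))"
proof -
  have "((\<lambda>\<nu>::real. 2 * \<nu>\<^sup>2 / (\<nu>\<^sup>2 + 1/4) * bures_limit i j r \<phi>) \<longlongrightarrow>
      2 * (1/2)\<^sup>2 / ((1/2)\<^sup>2 + 1/4) * bures_limit i j r \<phi>) (at_right (1/2))"
    by (intro tendsto_intros) (simp add: power2_eq_square)
  then have "((\<lambda>\<nu>::real. 2 * \<nu>\<^sup>2 / (\<nu>\<^sup>2 + 1/4) * bures_limit i j r \<phi>) \<longlongrightarrow>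
      bures_limit i j r \<phi>) (at_right (1/2))"
    by (simp add: power2_eq_square)
  then show ?thesis
    by (rule Lim_transform_eventually)
      (auto intro: eventually_mono[OF eventually_half_less] simp: bures_tangent assms)
qed

text \<open>The mixed radial-tangent coefficients are identically 0 for \<nu> > 1/2, so apart from
  the purely radial one only tangent pairs require a genuine limit.\<close>

lemma bures_convergent:
  assumes "(i, j) \<noteq> (Nu, Nu)"
  shows "\<exists>L. ((\<lambda>\<nu>. bures i j \<nu> r \<phi>) \<longlongrightarrow> L) (at_right (1/2))"
proof (cases "i = Nu \<or> j = Nu")
  case True
  have "((\<lambda>\<nu>. bures i j \<nu> r \<phi>) \<longlongrightarrow> 0) (at_right (1/2))"
    by (rule tendsto_eventually)
      (use True assms in \<open>auto intro: eventually_mono[OF eventually_half_less] simp: bures_Nu_tangent\<close>)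
  then show ?thesis by blast
next
  case False
  then show ?thesis using tendsto_bures_tangent by blast
qed

section \<open>Square-integrable functions\<close>

lemma L2_cmult [intro]: "L2 f \<Longrightarrow> L2 (\<lambda>x. c * f x)"
  by (auto simp: L2_def norm_mult power_mult_distrib)

lemma L2_add [intro]:
  assumes "L2 f" "L2 g"
  shows "L2 (\<lambda>x. f x + g x)"
  unfolding L2_def
proof
  have [measurable]: "f \<in> borel_measurable lborel" "g \<in> borel_measurable lborel"
    using assms by (auto simp: L2_def)
  show m: "(\<lambda>x. f x + g x) \<in> borel_measurable lborel"
    by measurable
  have "integrable lborel (\<lambda>x. 2 * (cmod (f x))\<^sup>2 + 2 * (cmod (g x))\<^sup>2)"
    using assms by (simp add: L2_def)
  then show "integrable lborel (\<lambda>x. (cmod (f x + g x))\<^sup>2)"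
  proof (rule Bochner_Integration.integrable_bound)
    have "(cmod (f x + g x))\<^sup>2 \<le> 2 * (cmod (f x))\<^sup>2 + 2 * (cmod (g x))\<^sup>2" for x
    proof -
      have "(cmod (f x + g x))\<^sup>2 \<le> (cmod (f x) + cmod (g x))\<^sup>2"
        by (intro power_mono norm_triangle_ineq) simp
      also have "\<dots> \<le> 2 * (cmod (f x))\<^sup>2 + 2 * (cmod (g x))\<^sup>2"
        using sum_squares_bound[of "cmod (f x)" "cmod (g x)"] by (simp add: power2_sum)
      finally show ?thesis .
    qed
    then show "AE x in lborel. norm ((cmod (f x + g x))\<^sup>2) \<le> norm (2 * (cmod (f x))\<^sup>2 + 2 * (cmod (g x))\<^sup>2)"
      by (intro AE_I2) simp
  qed (use m in measurable)
qed

lemma L2_diff [intro]: "L2 f \<Longrightarrow> L2 g \<Longrightarrow> L2 (\<lambda>x. f x - g x)"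
  using L2_add[OF _ L2_cmult[of g "- 1"], of f] by simp

lemma integrable_l2_inner:
  assumes "L2 f" "L2 g"
  shows "integrable lborel (\<lambda>x. cnj (f x) * g x)"
proof (rule Bochner_Integration.integrable_bound)
  show "integrable lborel (\<lambda>x. (cmod (f x))\<^sup>2 + (cmod (g x))\<^sup>2)"
    using assms by (simp add: L2_def)
  have [measurable]: "f \<in> borel_measurable lborel" "g \<in> borel_measurable lborel"
    using assms by (auto simp: L2_def)
  have "(\<lambda>x. cnj (f x)) \<in> borel_measurable lborel"
    by (rule borel_measurable_continuous_on[where f = cnj]) (auto intro: continuous_intros)
  then show "(\<lambda>x. cnj (f x) * g x) \<in> borel_measurable lborel"
    by measurable
  have "cmod (f x) * cmod (g x) \<le> (cmod (f x))\<^sup>2 + (cmod (g x))\<^sup>2" for x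
    using sum_squares_bound[of "cmod (f x)" "cmod (g x)"]
      mult_nonneg_nonneg[OF norm_ge_zero[of "f x"] norm_ge_zero[of "g x"]] by linarith
  then show "AE x in lborel. norm (cnj (f x) * g x) \<le> norm ((cmod (f x))\<^sup>2 + (cmod (g x))\<^sup>2)"
    by (intro AE_I2) (simp add: norm_mult)
qed

section \<open>Inner product and norm\<close>

lemma l2_inner_commute: "l2_inner g f = cnj (l2_inner f g)"
  
proof -
  have "cnj (l2_inner f g) = (LINT x|lborel. cnj (cnj (f x) * g x))"
    unfolding l2_inner_def by (rule Bochner_Integration.integral_cnj[symmetric])
  then show ?thesis by (simp add: l2_inner_def mult.commute)
qed

lemma l2_inner_cmult_right: "l2_inner f (\<lambda>x. c * g x) = c * l2_inner f g"
  unfolding l2_inner_def by (simp add: mult.left_commute)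

lemma l2_inner_cmult_left: "l2_inner (\<lambda>x. c * f x) g = cnj c * l2_inner f g"
  unfolding l2_inner_def by (simp add: mult.assoc)

lemma l2_inner_add_right:
  "L2 f \<Longrightarrow> L2 g \<Longrightarrow> L2 h \<Longrightarrow> l2_inner f (\<lambda>x. g x + h x) = l2_inner f g + l2_inner f h"
  unfolding l2_inner_def by (simp add: distrib_left integrable_l2_inner)

lemma l2_inner_add_left:
  "L2 f \<Longrightarrow> L2 g \<Longrightarrow> L2 h \<Longrightarrow> l2_inner (\<lambda>x. g x + h x) f = l2_inner g f + l2_inner h f"
  unfolding l2_inner_def by (simp add: distrib_right integrable_l2_inner)

lemma l2_inner_diff_right:
  "L2 f \<Longrightarrow> L2 g \<Longrightarrow> L2 h \<Longrightarrow> l2_inner f (\<lambda>x. g x - h x) = l2_inner f g - l2_inner f h"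
  unfolding l2_inner_def by (simp add: right_diff_distrib integrable_l2_inner)

lemma l2_inner_diff_left:
  "L2 f \<Longrightarrow> L2 g \<Longrightarrow> L2 h \<Longrightarrow> l2_inner (\<lambda>x. g x - h x) f = l2_inner g f - l2_inner h f"
  unfolding l2_inner_def by (simp add: left_diff_distrib integrable_l2_inner)

lemmas l2_inner_linear = l2_inner_cmult_right l2_inner_cmult_left l2_inner_add_right
  l2_inner_add_left l2_inner_diff_right l2_inner_diff_left

lemma l2_norm_nonneg [simp]: "l2_norm f \<ge> 0"
  by (simp add: l2_norm_def)

lemma l2_inner_self: "l2_inner f f = of_real ((l2_norm f)\<^sup>2)"
proof -
  have "l2_inner f f = (LINT x|lborel. of_real ((cmod (f x))\<^sup>2))"
    unfolding l2_inner_def by (simp only: complex_norm_square mult.commute)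
  then show ?thesis by (simp add: l2_norm_def del: of_real_power)
qed

lemma l2_norm_square: "(l2_norm f)\<^sup>2 = Re (l2_inner f f)"
  by (simp add: l2_inner_self)

lemma l2_norm_cmult: "l2_norm (\<lambda>x. c * f x) = cmod c * l2_norm f"
  by (simp add: l2_norm_def norm_mult power_mult_distrib real_sqrt_mult)

lemma l2_norm_mono:
  assumes "L2 f" "L2 g" "\<And>x. cmod (f x) \<le> cmod (g x)"
  shows "l2_norm f \<le> l2_norm g"
  unfolding l2_norm_def
  using assms by (intro real_sqrt_le_mono integral_mono power_mono) (auto simp: L2_def)

lemma l2_cauchy_schwarz:
  assumes f: "L2 f" and g: "L2 g"
  shows "cmod (l2_inner f g) \<le> l2_norm f * l2_norm g"
proof -
  define c F G where "c = l2_inner f g" and "F = (l2_norm f)\<^sup>2" and "G = (l2_norm g)\<^sup>2"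
  \<comment> \<open>Expand the squared norm of \<open>g - s c f\<close> with
    \<open>c = l2_inner f g\<close>. The factor \<open>c\<close> aligns the phases, so that a real
    parameter \<open>s\<close> suffices.\<close>
  have q: "0 \<le> G - 2 * s * (cmod c)\<^sup>2 + s\<^sup>2 * (cmod c)\<^sup>2 * F" for s :: real
  proof -
    have "complex_of_real ((l2_norm (\<lambda>x. g x - (of_real s * c) * f x))\<^sup>2)
      = l2_inner (\<lambda>x. g x - (of_real s * c) * f x) (\<lambda>x. g x - (of_real s * c) * f x)"
      by (simp add: l2_inner_self)
    also have "\<dots> = of_real G - of_real s * (c * cnj c) - of_real s * (cnj c * c)
        + of_real s * of_real s * (c * cnj c) * of_real F"
      using f g by (simp add: l2_inner_linear L2_cmult L2_diff l2_inner_self[of f] l2_inner_self[of g]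
          F_def G_def c_def[symmetric] l2_inner_commute[of g f]) (simp add: algebra_simps)
    also have "\<dots> = of_real (G - 2 * s * (cmod c)\<^sup>2 + s\<^sup>2 * (cmod c)\<^sup>2 * F)"
      unfolding mult.commute[of "cnj c"] complex_norm_square[symmetric]
      by (simp add: algebra_simps power2_eq_square)
    finally have "(l2_norm (\<lambda>x. g x - (of_real s * c) * f x))\<^sup>2 = G - 2 * s * (cmod c)\<^sup>2 + s\<^sup>2 * (cmod c)\<^sup>2 * F"
      by (simp only: of_real_eq_iff)
    then show ?thesis by (metis zero_le_power2)
  qed
  have "(cmod c)\<^sup>2 \<le> F * G"
  proof (cases "F = 0")
    case True
    have "c = 0"
    proof (rule ccontr)
      assume "c \<noteq> 0"
      \<comment> \<open>With \<open>F = 0\<close> the bound is affine in \<open>s\<close>, and this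
        value of \<open>s\<close> makes it \<open>G - 2 (G + 1)\<close>, which is negative.\<close>
      then show False using q[of "(G + 1) / (cmod c)\<^sup>2"] True
        by (simp add: G_def F_def) (smt (verit) zero_le_power2)
    qed
    then show ?thesis using True by simp
  next
    case False
    then have "F > 0" by (simp add: F_def)
    \<comment> \<open>The minimum of the quadratic polynomial lies at
      \<open>s = 1 / F\<close>.\<close>
    then show ?thesis using q[of "1 / F"] by (simp add: field_simps power2_eq_square)
  qed
  then have "(cmod c)\<^sup>2 \<le> (l2_norm f * l2_norm g)\<^sup>2"
    by (simp add: F_def G_def power_mult_distrib)
  then show ?thesis unfolding c_def by (rule power2_le_imp_le) simp
qed

lemma l2_norm_triangle:
  assumes f: "L2 f" and g: "L2 g"
  shows "l2_norm (\<lambda>x. f x + g x) \<le> l2_norm f + l2_norm g"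
proof (rule power2_le_imp_le)
  have "(l2_norm (\<lambda>x. f x + g x))\<^sup>2 = (l2_norm f)\<^sup>2 + (l2_norm g)\<^sup>2 + 2 * Re (l2_inner f g)"
    using f g by (simp add: l2_norm_square l2_inner_linear L2_add l2_inner_commute[of g f])
  also have "Re (l2_inner f g) \<le> l2_norm f * l2_norm g"
    using complex_Re_le_cmod l2_cauchy_schwarz[OF f g] by (rule order_trans)
  finally show "(l2_norm (\<lambda>x. f x + g x))\<^sup>2 \<le> (l2_norm f + l2_norm g)\<^sup>2"
    by (simp add: power2_sum)
qed simp

lemma l2_norm_diff_le:
  assumes f: "L2 f" and g: "L2 g"
  shows "\<bar>l2_norm f - l2_norm g\<bar> \<le> l2_norm (\<lambda>x. f x - g x)"
proof -
  have "l2_norm f \<le> l2_norm g + l2_norm (\<lambda>x. f x - g x)"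
    using l2_norm_triangle[OF g L2_diff[OF f g]] by simp
  moreover have "l2_norm g \<le> l2_norm f + l2_norm (\<lambda>x. (- 1) * (f x - g x))"
    using l2_norm_triangle[OF f L2_cmult[OF L2_diff[OF f g], of "- 1"]] by simp
  ultimately show ?thesis by (simp only: l2_norm_cmult) simp
qed

section \<open>Projection away from a ray and the Fubini--Study form\<close>

definition ray_proj :: "(real \<Rightarrow> complex) \<Rightarrow> (real \<Rightarrow> complex) \<Rightarrow> real \<Rightarrow> complex" where
  "ray_proj \<psi> f = (\<lambda>x. f x - l2_inner \<psi> f * \<psi> x)"

lemma L2_ray_proj [intro]: "L2 \<psi> \<Longrightarrow> L2 f \<Longrightarrow> L2 (ray_proj \<psi> f)"
  unfolding ray_proj_def by auto

lemma l2_norm_ray_proj: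
  assumes "L2 \<psi>" "l2_norm \<psi> = 1" "L2 f"
  shows "(l2_norm (ray_proj \<psi> f))\<^sup>2 = (l2_norm f)\<^sup>2 - (cmod (l2_inner \<psi> f))\<^sup>2"
proof -
  let ?c = "l2_inner \<psi> f"
  have "complex_of_real ((l2_norm (ray_proj \<psi> f))\<^sup>2) = of_real ((l2_norm f)\<^sup>2) - ?c * cnj ?c"
    unfolding l2_inner_self[symmetric] ray_proj_def
    using assms by (simp add: l2_inner_linear L2_cmult L2_diff l2_inner_self[of \<psi>]
        l2_inner_commute[of f \<psi>])
  also have "\<dots> = of_real ((l2_norm f)\<^sup>2 - (cmod ?c)\<^sup>2)"
    unfolding complex_norm_square[symmetric] by simp
  finally show ?thesis by (simp only: of_real_eq_iff)
qed

lemma l2_norm_ray_proj_le: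
  assumes "L2 \<psi>" "l2_norm \<psi> = 1" "L2 f"
  shows "l2_norm (ray_proj \<psi> f) \<le> l2_norm f"
  by (rule power2_le_imp_le) (simp_all add: l2_norm_ray_proj assms)

text \<open>The subtracted term is exactly the component along the ray of the unit vector, so the
  form is the squared length of the orthogonal component. This turns estimates on the metric into
  estimates on \<open>ray_proj\<close>.\<close>

lemma fubini_study_self:
  assumes "L2 \<psi>" "l2_norm \<psi> = 1" "L2 f"
  shows "fubini_study \<psi> f f = (l2_norm (ray_proj \<psi> f))\<^sup>2"
proof -
  have "l2_inner f \<psi> * l2_inner \<psi> f = of_real ((cmod (l2_inner \<psi> f))\<^sup>2)"
    by (simp only: complex_norm_square l2_inner_commute[of f \<psi>] mult.commute)
  then show ?thesis
    unfolding fubini_study_def l2_norm_ray_proj[OF assms] by (simp add: l2_inner_self del: of_real_power)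
qed

lemma fubini_study_commute: "fubini_study \<psi> f g = fubini_study \<psi> g f"
proof -
  have "l2_inner g f - l2_inner g \<psi> * l2_inner \<psi> f = cnj (l2_inner f g - l2_inner f \<psi> * l2_inner \<psi> g)"
    by (simp only: complex_cnj_diff complex_cnj_mult l2_inner_commute[symmetric] mult.commute)
  then show ?thesis by (simp only: fubini_study_def cnj.simps)
qed

lemma fubini_study_polar:
  assumes "L2 \<psi>" "L2 f" "L2 g"
  shows "fubini_study \<psi> f g = (fubini_study \<psi> (\<lambda>x. f x + g x) (\<lambda>x. f x + g x)
     - fubini_study \<psi> f f - fubini_study \<psi> g g) / 2"
proof -
  have "fubini_study \<psi> (\<lambda>x. f x + g x) (\<lambda>x. f x + g x) = fubini_study \<psi> f f + fubini_study \<psi> g g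
      + fubini_study \<psi> f g + fubini_study \<psi> g f"
    unfolding fubini_study_def using assms by (simp add: l2_inner_linear L2_add algebra_simps)
  then show ?thesis using fubini_study_commute[of \<psi> g f] by simp
qed

text \<open>For unit vectors, one minus the squared overlap is the squared norm of the projected
  vector. The projection kills the base vector itself, so what remains is \<epsilon> times the
  projected derivative plus a remainder of order o(\<epsilon>). The left-hand side depends only on
  rays, which makes the metric computable without any choice of phase.\<close>

lemma fubini_study_overlap:
  assumes d: "has_l2_partials \<psi> u v r \<phi>"
    and L: "\<And>r \<phi>. L2 (\<psi> r \<phi>)" and one: "\<And>r \<phi>. l2_norm (\<psi> r \<phi>) = 1"
    and st: "(s, t) \<noteq> (0, 0)"
  defines "w \<equiv> \<lambda>x. of_real s * u x + of_real t * v x"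
  shows "((\<lambda>\<epsilon>. (1 - (cmod (l2_inner (\<psi> r \<phi>) (\<psi> (r + \<epsilon> * s) (\<phi> + \<epsilon> * t))))\<^sup>2) / \<epsilon>\<^sup>2)
     \<longlongrightarrow> fubini_study (\<psi> r \<phi>) w w) (at 0)"
proof -
  let ?\<psi> = "\<psi> r \<phi>"
  let ?q = "\<lambda>\<epsilon>. \<psi> (r + \<epsilon> * s) (\<phi> + \<epsilon> * t)"
  define R where "R \<epsilon> = (\<lambda>x. ?q \<epsilon> x - ?\<psi> x - of_real (\<epsilon> * s) * u x - of_real (\<epsilon> * t) * v x)" for \<epsilon>
  have uv: "L2 u" "L2 v" using d by (auto simp: has_l2_partials_def)
  then have w: "L2 w" by (auto simp: w_def)
  have R: "L2 (R \<epsilon>)" for \<epsilon> unfolding R_def using uv L by (intro L2_diff L2_cmult) auto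
  have lim: "((\<lambda>\<epsilon>. l2_norm (R \<epsilon>) / \<bar>\<epsilon>\<bar>) \<longlongrightarrow> 0) (at 0)"
  proof -
    \<comment> \<open>The limit is taken along the line \<open>h = \<epsilon> (s, t)\<close>; as
      \<open>(s, t)\<close> is nonzero, the line meets the origin only at \<epsilon> = 0.\<close>
    have "filterlim (\<lambda>\<epsilon>. \<epsilon> *\<^sub>R (s, t)) (at 0) (at (0::real))"
      unfolding filterlim_at
    proof
      show "((\<lambda>\<epsilon>. \<epsilon> *\<^sub>R (s, t)) \<longlongrightarrow> 0) (at (0::real))"
        by (rule tendsto_eq_rhs, rule tendsto_intros, rule tendsto_ident_at, rule tendsto_const) (simp add: zero_prod_def)
      show "eventually (\<lambda>\<epsilon>. \<epsilon> *\<^sub>R (s, t) \<in> UNIV \<and> \<epsilon> *\<^sub>R (s, t) \<noteq> 0) (at (0::real))"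
        using st by (auto simp: eventually_at_filter zero_prod_def)
    qed
    from filterlim_compose[OF conjunct2[OF conjunct2[OF d[unfolded has_l2_partials_def]]] this]
    have "((\<lambda>\<epsilon>. l2_norm (R \<epsilon>) / (\<bar>\<epsilon>\<bar> * norm (s, t))) \<longlongrightarrow> 0) (at 0)"
      using norm_scaleR[of _ "(s, t)"] by (simp add: R_def)
    moreover have "norm (s, t) \<noteq> 0"
      using st unfolding norm_eq_zero zero_prod_def .
    ultimately show ?thesis
      using tendsto_mult_right[of "\<lambda>\<epsilon>. l2_norm (R \<epsilon>) / (\<bar>\<epsilon>\<bar> * norm (s, t))" 0 "at 0" "norm (s, t)"]
      by simp
  qed
  have split: "ray_proj ?\<psi> (?q \<epsilon>) = (\<lambda>x. of_real \<epsilon> * ray_proj ?\<psi> w x + ray_proj ?\<psi> (R \<epsilon>) x)" for \<epsilon>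
  proof -
    \<comment> \<open>The 1 is the inner product of the base vector with itself; it makes the base
      vector drop out of the projection.\<close>
    have inner: "l2_inner ?\<psi> (R \<epsilon>) = l2_inner ?\<psi> (?q \<epsilon>) - 1 - of_real \<epsilon> * l2_inner ?\<psi> w"
      unfolding R_def w_def using uv L
      by (simp add: l2_inner_linear L2_diff L2_cmult L2_add l2_inner_self one algebra_simps)
    have R_eq: "R \<epsilon> x = ?q \<epsilon> x - ?\<psi> x - of_real \<epsilon> * w x" for x
      by (simp add: R_def w_def algebra_simps)
    show ?thesis
      unfolding ray_proj_def inner R_eq by (simp add: algebra_simps)
  qed
  have bound: "\<bar>l2_norm (ray_proj ?\<psi> (?q \<epsilon>)) - \<bar>\<epsilon>\<bar> * l2_norm (ray_proj ?\<psi> w)\<bar> \<le> l2_norm (R \<epsilon>)" for \<epsilon>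
  proof -
    have "\<bar>l2_norm (ray_proj ?\<psi> (?q \<epsilon>)) - l2_norm (\<lambda>x. of_real \<epsilon> * ray_proj ?\<psi> w x)\<bar>
        \<le> l2_norm (\<lambda>x. ray_proj ?\<psi> (?q \<epsilon>) x - of_real \<epsilon> * ray_proj ?\<psi> w x)"
      using L w by (intro l2_norm_diff_le) auto
    also have "\<dots> = l2_norm (ray_proj ?\<psi> (R \<epsilon>))"
      by (simp add: split)
    also have "\<dots> \<le> l2_norm (R \<epsilon>)" by (rule l2_norm_ray_proj_le[OF L one R])
    finally show ?thesis by (simp add: l2_norm_cmult)
  qed
  have "((\<lambda>\<epsilon>. l2_norm (ray_proj ?\<psi> (?q \<epsilon>)) / \<bar>\<epsilon>\<bar> - l2_norm (ray_proj ?\<psi> w)) \<longlongrightarrow> 0) (at 0)"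
  proof (rule Lim_null_comparison[OF _ lim])
    have "norm (l2_norm (ray_proj ?\<psi> (?q \<epsilon>)) / \<bar>\<epsilon>\<bar> - l2_norm (ray_proj ?\<psi> w))
      \<le> l2_norm (R \<epsilon>) / \<bar>\<epsilon>\<bar>" if "\<epsilon> \<noteq> 0" for \<epsilon>
    proof -
      have "l2_norm (ray_proj ?\<psi> (?q \<epsilon>)) / \<bar>\<epsilon>\<bar> - l2_norm (ray_proj ?\<psi> w)
         = (l2_norm (ray_proj ?\<psi> (?q \<epsilon>)) - \<bar>\<epsilon>\<bar> * l2_norm (ray_proj ?\<psi> w)) / \<bar>\<epsilon>\<bar>"
        using that by (simp add: field_simps)
      then show ?thesis using bound[of \<epsilon>] that by (simp add: divide_right_mono)
    qed
    then show "eventually (\<lambda>\<epsilon>. norm (l2_norm (ray_proj ?\<psi> (?q \<epsilon>)) / \<bar>\<epsilon>\<bar> - l2_norm (ray_proj ?\<psi> w))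
      \<le> l2_norm (R \<epsilon>) / \<bar>\<epsilon>\<bar>) (at 0)"
      by (simp add: eventually_at_filter)
  qed
  then have "((\<lambda>\<epsilon>. l2_norm (ray_proj ?\<psi> (?q \<epsilon>)) / \<bar>\<epsilon>\<bar>) \<longlongrightarrow> l2_norm (ray_proj ?\<psi> w)) (at 0)"
    by (simp add: Lim_null[symmetric])
  from tendsto_power[OF this, of 2] show ?thesis
    by (simp add: power_divide l2_norm_ray_proj L one fubini_study_self w)
qed

text \<open>The unimodular factor is chosen separately at each point and may vary without any
  regularity, so the two families of partial derivatives cannot be compared directly. The moduli of
  overlaps agree, hence so do their second-order limits, hence the quadratic forms; polarisation
  yields the mixed component.\<close>

lemma fubini_study_ray:
  assumes "has_l2_partials \<psi> u v r \<phi>" "\<And>r \<phi>. L2 (\<psi> r \<phi>)" "\<And>r \<phi>. l2_norm (\<psi> r \<phi>) = 1"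
    and "has_l2_partials \<eta> u' v' r \<phi>" "\<And>r \<phi>. L2 (\<eta> r \<phi>)" "\<And>r \<phi>. l2_norm (\<eta> r \<phi>) = 1"
    and ray: "\<And>r \<phi>. \<exists>\<theta>. cmod \<theta> = 1 \<and> \<psi> r \<phi> = (\<lambda>x. \<theta> * \<eta> r \<phi> x)"
  shows "fubini_study (\<psi> r \<phi>) u u = fubini_study (\<eta> r \<phi>) u' u'"
    "fubini_study (\<psi> r \<phi>) u v = fubini_study (\<eta> r \<phi>) u' v'"
    "fubini_study (\<psi> r \<phi>) v v = fubini_study (\<eta> r \<phi>) v' v'"
proof -
  have overlap: "cmod (l2_inner (\<psi> r \<phi>) (\<psi> r' \<phi>')) = cmod (l2_inner (\<eta> r \<phi>) (\<eta> r' \<phi>'))" for r' \<phi>'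
  proof -
    obtain \<theta> \<theta>' where "cmod \<theta> = 1" "\<psi> r \<phi> = (\<lambda>x. \<theta> * \<eta> r \<phi> x)"
      "cmod \<theta>' = 1" "\<psi> r' \<phi>' = (\<lambda>x. \<theta>' * \<eta> r' \<phi>' x)" using ray by metis
    then show ?thesis by (simp add: l2_inner_cmult_left l2_inner_cmult_right norm_mult)
  qed
  have dir: "fubini_study (\<psi> r \<phi>) (\<lambda>x. of_real s * u x + of_real t * v x) (\<lambda>x. of_real s * u x + of_real t * v x)
    = fubini_study (\<eta> r \<phi>) (\<lambda>x. of_real s * u' x + of_real t * v' x) (\<lambda>x. of_real s * u' x + of_real t * v' x)"
    if "(s, t) \<noteq> (0, 0)" for s t
    using fubini_study_overlap[OF assms(1-3) that, unfolded overlap]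
      fubini_study_overlap[OF assms(4-6) that]
    by (rule tendsto_unique[rotated]) simp
  have L: "L2 u" "L2 v" "L2 u'" "L2 v'" using assms(1,4) by (auto simp: has_l2_partials_def)
  show 1: "fubini_study (\<psi> r \<phi>) u u = fubini_study (\<eta> r \<phi>) u' u'" using dir[of 1 0] by simp
  show 2: "fubini_study (\<psi> r \<phi>) v v = fubini_study (\<eta> r \<phi>) v' v'" using dir[of 0 1] by simp
  \<comment> \<open>The direction (1, 1) together with the two axes determines a symmetric bilinear
    form on the plane.\<close>
  show "fubini_study (\<psi> r \<phi>) u v = fubini_study (\<eta> r \<phi>) u' v'"
    using dir[of 1 1] 1 2 by (simp add: fubini_study_polar[of _ u v] fubini_study_polar[of _ u' v'] assms L)
qed

section \<open>Gaussian wave functions\<close>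

lemma l2_norm_scaled_mono:
  assumes "L2 f" "L2 g" "K \<ge> 0" "\<And>x. cmod (f x) \<le> K * cmod (g x)"
  shows "l2_norm f \<le> K * l2_norm g"
proof -
  have "l2_norm f \<le> l2_norm (\<lambda>x. of_real K * g x)"
    using assms by (intro l2_norm_mono L2_cmult) (auto simp: norm_mult)
  then show ?thesis using assms(3) by (simp add: l2_norm_cmult)
qed

text \<open>The linear term is left out because centering forces it to vanish, see
  \<open>pure_gaussianE\<close>. When the norm is 1, the position variance is
  \<open>1 / (4 Re a)\<close>; \<open>Im a\<close> carries the position-momentum correlation, and
  \<open>c\<close> the norm and the phase.\<close>

definition gauss :: "complex \<Rightarrow> complex \<Rightarrow> real \<Rightarrow> complex" where
  "gauss a c x = exp (- a * (of_real x)\<^sup>2 + c)"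

text \<open>Completing the square in the exponent of the squared modulus; the constant left over is
  absorbed into \<open>K\<close>. All later integrals thereby become moments of a normal
  distribution.\<close>

lemma cmod_exp_quadratic:
  assumes "Re a > 0"
  obtains K where "K > 0"
    "\<And>x. (cmod (exp (- a * (of_real x)\<^sup>2 + b * of_real x + c)))\<^sup>2
      = K * normal_density (Re b / (2 * Re a)) (1 / (2 * sqrt (Re a))) x"
proof
  let ?\<mu> = "Re b / (2 * Re a)" and ?\<sigma> = "1 / (2 * sqrt (Re a))"
  let ?K = "sqrt (2 * pi * ?\<sigma>\<^sup>2) * exp (2 * Re c + (Re b)\<^sup>2 / (2 * Re a))"
  have \<sigma>: "?\<sigma>\<^sup>2 = 1 / (4 * Re a)" using assms by (simp add: power_divide power_mult_distrib)
  show "?K > 0" using assms by simp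
  fix x
  have "(cmod (exp (- a * (of_real x)\<^sup>2 + b * of_real x + c)))\<^sup>2 = exp (2 * (- Re a * x\<^sup>2 + Re b * x + Re c))"
    by (simp flip: exp_double of_real_power)
  also have "2 * (- Re a * x\<^sup>2 + Re b * x + Re c)
      = (2 * Re c + (Re b)\<^sup>2 / (2 * Re a)) + (- (x - ?\<mu>)\<^sup>2 / (2 * ?\<sigma>\<^sup>2))"
    unfolding \<sigma> using assms by (simp add: field_simps power2_eq_square)
  also have "exp \<dots> = ?K * normal_density ?\<mu> ?\<sigma> x"
    unfolding exp_add normal_density_def using assms by simp
  finally show "(cmod (exp (- a * (of_real x)\<^sup>2 + b * of_real x + c)))\<^sup>2 = ?K * normal_density ?\<mu> ?\<sigma> x" .
qed

lemma L2_gauss_monomial: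
  assumes a: "Re a > 0"
  shows "L2 (\<lambda>x. of_real (x ^ k) * gauss a c x)"
proof -
  obtain K where K: "\<And>x. (cmod (exp (- a * (of_real x)\<^sup>2 + 0 * of_real x + c)))\<^sup>2
      = K * normal_density (Re 0 / (2 * Re a)) (1 / (2 * sqrt (Re a))) x"
    using cmod_exp_quadratic[OF a, where b = 0 and c = c] by metis
  have "integrable lborel (\<lambda>x. K * (normal_density 0 (1 / (2 * sqrt (Re a))) x * (x - 0) ^ (2 * k)))"
    using a by (intro integrable_mult_right integrable_normal_moment) simp
  moreover have "(cmod (of_real (x ^ k) * gauss a c x))\<^sup>2
      = K * (normal_density 0 (1 / (2 * sqrt (Re a))) x * (x - 0) ^ (2 * k))" for x
  proof -
    have "(cmod (of_real (x ^ k)))\<^sup>2 = (x - 0) ^ (2 * k)"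
      unfolding norm_of_real power2_abs by (simp add: mult.commute flip: power_mult)
    then show ?thesis
      using K[of x] by (simp add: gauss_def norm_mult power_mult_distrib del: of_real_power)
  qed
  moreover have "(\<lambda>x. of_real (x ^ k) * gauss a c x) \<in> borel_measurable lborel"
    unfolding gauss_def
    using borel_measurable_continuous_onI[of "\<lambda>x. of_real (x ^ k) * exp (- a * (of_real x)\<^sup>2 + c)"]
    by (simp add: continuous_intros)
  ultimately show ?thesis by (simp add: L2_def)
qed

lemma L2_gauss: "L2 (gauss a c)" if "Re a > 0"
  using L2_gauss_monomial[OF that, of 0 c] by simp

lemma L2_gauss_quadratic: "L2 (\<lambda>x. (p + q * of_real (x\<^sup>2)) * gauss a c x)" if "Re a > 0"
proof -
  have "L2 (\<lambda>x. p * gauss a c x + q * (of_real (x\<^sup>2) * gauss a c x))"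
    by (intro L2_add L2_cmult L2_gauss L2_gauss_monomial that)
  then show ?thesis by (simp add: algebra_simps)
qed

text \<open>The density integrates to 1, so the constant \<open>K\<close> is the squared norm of the
  wave function.\<close>

lemma gauss_density:
  assumes a: "Re a > 0" and one: "l2_norm (\<lambda>x. exp (- a * (of_real x)\<^sup>2 + b * of_real x + c)) = 1"
  shows "(cmod (exp (- a * (of_real x)\<^sup>2 + b * of_real x + c)))\<^sup>2
      = normal_density (Re b / (2 * Re a)) (1 / (2 * sqrt (Re a))) x"
proof -
  obtain K where K: "K > 0" "\<And>x. (cmod (exp (- a * (of_real x)\<^sup>2 + b * of_real x + c)))\<^sup>2
      = K * normal_density (Re b / (2 * Re a)) (1 / (2 * sqrt (Re a))) x"
    using cmod_exp_quadratic[OF a] by metis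
  have "1 = (LINT x|lborel. K * normal_density (Re b / (2 * Re a)) (1 / (2 * sqrt (Re a))) x)"
    using one unfolding l2_norm_def K(2) by simp
  also have "\<dots> = K" using a by simp
  finally show ?thesis using K by simp
qed

context
  fixes \<psi> :: "real \<Rightarrow> complex" and \<sigma> \<mu> :: real
  assumes \<sigma>: "\<sigma> > 0" and dens: "\<And>x. (cmod (\<psi> x))\<^sup>2 = normal_density \<mu> \<sigma> x"
begin

lemma density_l2_norm: "l2_norm \<psi> = 1"
  using \<sigma> by (simp add: l2_norm_def dens)

lemma density_inner: "l2_inner (\<lambda>x. p x * \<psi> x) (\<lambda>x. q x * \<psi> x)
    = (LINT x|lborel. (cnj (p x) * q x) * of_real (normal_density \<mu> \<sigma> x))"
proof -
  have "cnj (p x * \<psi> x) * (q x * \<psi> x) = (cnj (p x) * q x) * (\<psi> x * cnj (\<psi> x))" for x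
    by (simp add: algebra_simps)
  then show ?thesis unfolding l2_inner_def
    by (simp only: complex_norm_square[symmetric] dens)
qed

lemma density_inner_linear:
  "l2_inner \<psi> (\<lambda>x. (p + q * of_real x) * \<psi> x) = p + q * of_real \<mu>"
proof -
  have 0: "has_bochner_integral lborel (\<lambda>x. p * complex_of_real (normal_density \<mu> \<sigma> x)) (p * of_real 1)"
    using has_bochner_integral_integrable[OF integrable_normal_density[OF \<sigma>]] \<sigma>
    by (intro has_bochner_integral_mult_right has_bochner_integral_of_real) simp
  have 1: "has_bochner_integral lborel (\<lambda>x. q * complex_of_real (normal_density \<mu> \<sigma> x * x)) (q * of_real \<mu>)"
    by (intro has_bochner_integral_mult_right has_bochner_integral_of_real normal_moment_nz_1 \<sigma>)
  have "(LINT x|lborel. (p + q * of_real x) * of_real (normal_density \<mu> \<sigma> x)) = p + q * of_real \<mu>"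
    using has_bochner_integral_integral_eq[OF has_bochner_integral_add[OF 0 1]]
    by (simp add: algebra_simps)
  then show ?thesis using density_inner[of "\<lambda>x. 1" "\<lambda>x. p + q * of_real x"] by simp
qed

end

text \<open>The moments of order 0, 2 and 4 of the centered normal law are 1,
  \<open>\<sigma>^2\<close> and \<open>3 \<sigma>^4\<close>; \<open>m k\<close> is the integrand of
  the moment of order \<open>2 k\<close>.\<close>

lemma density_inner_quadratic:
  assumes \<sigma>: "\<sigma> > 0" and dens: "\<And>x. (cmod (\<psi> x))\<^sup>2 = normal_density 0 \<sigma> x"
  shows "l2_inner (\<lambda>x. (p + q * of_real (x\<^sup>2)) * \<psi> x) (\<lambda>x. (p' + q' * of_real (x\<^sup>2)) * \<psi> x)
    = cnj p * p' + (cnj p * q' + cnj q * p') * of_real (\<sigma>\<^sup>2) + cnj q * q' * of_real (3 * \<sigma> ^ 4)"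
proof -
  define m where "m k = (\<lambda>x. complex_of_real (normal_density 0 \<sigma> x * (x - 0) ^ (2 * k)))" for k
  have m: "has_bochner_integral lborel (m k) (of_real (fact (2 * k) / ((2 / \<sigma>\<^sup>2) ^ k * fact k)))" for k
    unfolding m_def by (intro has_bochner_integral_of_real normal_moment_even \<sigma>)
  have "has_bochner_integral lborel
     (\<lambda>x. (cnj p * p') * m 0 x + (cnj p * q' + cnj q * p') * m 1 x + (cnj q * q') * m 2 x)
     ((cnj p * p') * of_real (fact (2 * 0) / ((2 / \<sigma>\<^sup>2) ^ 0 * fact 0))
      + (cnj p * q' + cnj q * p') * of_real (fact (2 * 1) / ((2 / \<sigma>\<^sup>2) ^ 1 * fact 1))
      + (cnj q * q') * of_real (fact (2 * 2) / ((2 / \<sigma>\<^sup>2) ^ 2 * fact 2)))"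
    by (intro has_bochner_integral_add has_bochner_integral_mult_right m)
  also have "(\<lambda>x. (cnj p * p') * m 0 x + (cnj p * q' + cnj q * p') * m 1 x + (cnj q * q') * m 2 x)
    = (\<lambda>x. (cnj (p + q * of_real (x\<^sup>2)) * (p' + q' * of_real (x\<^sup>2))) * of_real (normal_density 0 \<sigma> x))"
    by (simp add: m_def fun_eq_iff algebra_simps power2_eq_square power4_eq_xxxx)
  finally show ?thesis
    unfolding density_inner[OF \<sigma> dens]
    by (simp add: has_bochner_integral_integral_eq fact_numeral power_divide)
qed

section \<open>Covariance of Gaussian wave functions\<close>

lemma momentum_gauss:
  "momentum (\<lambda>x. exp (- a * (of_real x)\<^sup>2 + b * of_real x + c))
     = (\<lambda>x. (- \<i> * b + 2 * \<i> * a * of_real x) * exp (- a * (of_real x)\<^sup>2 + b * of_real x + c))"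
proof
  fix x
  have "((\<lambda>x. exp (- a * (of_real x)\<^sup>2 + b * of_real x + c)) has_vector_derivative
     (b - 2 * a * of_real x) * exp (- a * (of_real x)\<^sup>2 + b * of_real x + c)) (at x)"
    by (rule has_vector_derivative_real_field) (auto intro!: derivative_eq_intros simp: algebra_simps)
  then show "momentum (\<lambda>x. exp (- a * (of_real x)\<^sup>2 + b * of_real x + c)) x
     = (- \<i> * b + 2 * \<i> * a * of_real x) * exp (- a * (of_real x)\<^sup>2 + b * of_real x + c)"
    by (simp add: momentum_def vector_derivative_at algebra_simps)
qed

lemma momentum_linear_gauss:
  "momentum (\<lambda>x. k * of_real x * gauss a c x)
     = (\<lambda>x. (- \<i> * k + 2 * \<i> * a * k * of_real (x\<^sup>2)) * gauss a c x)"
proof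
  fix x
  have "((\<lambda>x. k * of_real x * gauss a c x) has_vector_derivative
     (k - 2 * a * k * (of_real x)\<^sup>2) * gauss a c x) (at x)"
    unfolding gauss_def
    by (rule has_vector_derivative_real_field)
      (auto intro!: derivative_eq_intros simp: algebra_simps power2_eq_square)
  then show "momentum (\<lambda>x. k * of_real x * gauss a c x) x
     = (- \<i> * k + 2 * \<i> * a * k * of_real (x\<^sup>2)) * gauss a c x"
    by (simp add: momentum_def vector_derivative_at algebra_simps)
qed

lemma state_covar_gauss:
  assumes a: "Re a > 0" and one: "l2_norm (gauss a c) = 1"
  shows "state_covar (gauss a c) = sym2 (1 / (4 * Re a)) (- Im a / (2 * Re a)) ((cmod a)\<^sup>2 / Re a)"
proof -
  define \<sigma> where "\<sigma> = 1 / (2 * sqrt (Re a))"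
  have \<sigma>: "\<sigma> > 0" and \<sigma>2: "\<sigma>\<^sup>2 = 1 / (4 * Re a)"
    using a by (auto simp: \<sigma>_def power_divide power_mult_distrib)
  have dens: "(cmod (gauss a c x))\<^sup>2 = normal_density 0 \<sigma> x" for x
    using gauss_density[of a 0 c x] a one by (simp add: gauss_def[abs_def] \<sigma>_def)
  have inner: "l2_inner (gauss a c) (\<lambda>x. (p + q * of_real (x\<^sup>2)) * gauss a c x)
      = p + q * of_real (\<sigma>\<^sup>2)" for p q
    using density_inner_quadratic[OF \<sigma> dens, of 1 0 p q] by simp
  have P: "momentum (gauss a c) = (\<lambda>x. 2 * \<i> * a * of_real x * gauss a c x)"
    using momentum_gauss[of a 0 c] by (simp add: gauss_def[abs_def])
  have XX: "position (position (gauss a c)) = (\<lambda>x. (0 + 1 * of_real (x\<^sup>2)) * gauss a c x)"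
    by (simp add: position_def power2_eq_square mult.assoc)
  have XP: "position (momentum (gauss a c)) = (\<lambda>x. (0 + 2 * \<i> * a * of_real (x\<^sup>2)) * gauss a c x)"
    unfolding P by (simp add: position_def power2_eq_square algebra_simps)
  have PX: "momentum (position (gauss a c)) = (\<lambda>x. (- \<i> + 2 * \<i> * a * of_real (x\<^sup>2)) * gauss a c x)"
    using momentum_linear_gauss[of 1 a c] by (simp add: position_def)
  have PP: "momentum (momentum (gauss a c)) = (\<lambda>x. (2 * a + (- 4 * a * a) * of_real (x\<^sup>2)) * gauss a c x)"
    unfolding P momentum_linear_gauss by (simp add: fun_eq_iff algebra_simps)
  have eqs: "l2_inner (gauss a c) (position (position (gauss a c))) = of_real (\<sigma>\<^sup>2)"
    "l2_inner (gauss a c) (position (momentum (gauss a c))) = 2 * \<i> * a * of_real (\<sigma>\<^sup>2)"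
    "l2_inner (gauss a c) (momentum (position (gauss a c))) = - \<i> + 2 * \<i> * a * of_real (\<sigma>\<^sup>2)"
    "l2_inner (gauss a c) (momentum (momentum (gauss a c))) = 2 * a - 4 * a * a * of_real (\<sigma>\<^sup>2)"
    unfolding XX XP PX PP inner by simp_all
  \<comment> \<open>The remaining entries are immediate: the two mixed products differ by the
    commutator, which is imaginary and does not survive the real part.\<close>
  have "Re (2 * a - 4 * a * a * of_real (\<sigma>\<^sup>2)) = (cmod a)\<^sup>2 / Re a"
    unfolding \<sigma>2 cmod_power2 using a by (simp add: field_simps power2_eq_square)
  then show ?thesis
    unfolding mat2_eq_iff state_covar_def using a
    by (simp add: quad_def eqs \<sigma>2 del: of_real_power)
qed

lemma centered_gauss:
  assumes a: "Re a > 0" and one: "l2_norm (gauss a c) = 1"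
  shows "centered (gauss a c)"
proof -
  define \<sigma> where "\<sigma> = 1 / (2 * sqrt (Re a))"
  have \<sigma>: "\<sigma> > 0" using a by (auto simp: \<sigma>_def)
  have dens: "(cmod (gauss a c x))\<^sup>2 = normal_density 0 \<sigma> x" for x
    using gauss_density[of a 0 c x] a one by (simp add: gauss_def[abs_def] \<sigma>_def)
  show ?thesis
    using density_inner_linear[OF \<sigma> dens, of 0 1] density_inner_linear[OF \<sigma> dens, of 0 "2 * \<i> * a"]
      momentum_gauss[of a 0 c]
    by (simp add: centered_def forall_2 quad_def position_def gauss_def[abs_def])
qed

lemma pure_gaussian_gauss:
  assumes "Re a > 0" "l2_norm (gauss a c) = 1"
  shows "pure_gaussian (sym2 (1 / (4 * Re a)) (- Im a / (2 * Re a)) ((cmod a)\<^sup>2 / Re a)) (gauss a c)"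
proof -
  have "gauss a c = (\<lambda>x. exp (- a * (of_real x)\<^sup>2 + 0 * of_real x + c))"
    by (simp add: gauss_def fun_eq_iff)
  then have "gaussian_wf (gauss a c)" using assms(1) unfolding gaussian_wf_def by blast
  with assms show ?thesis by (simp add: pure_gaussian_def state_covar_gauss centered_gauss)
qed

lemma pure_gaussianE:
  assumes "pure_gaussian S \<psi>"
  obtains a c where "Re a > 0" "\<psi> = gauss a c" "l2_norm \<psi> = 1"
    "S = sym2 (1 / (4 * Re a)) (- Im a / (2 * Re a)) ((cmod a)\<^sup>2 / Re a)"
proof -
  obtain a b c where a: "Re a > 0" and \<psi>: "\<psi> = (\<lambda>x. exp (- a * (of_real x)\<^sup>2 + b * of_real x + c))"
    and one: "l2_norm \<psi> = 1" and cen: "centered \<psi>" and S: "state_covar \<psi> = S"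
    using assms by (auto simp: pure_gaussian_def gaussian_wf_def)
  have \<sigma>: "1 / (2 * sqrt (Re a)) > 0" using a by simp
  have dens: "(cmod (\<psi> x))\<^sup>2 = normal_density (Re b / (2 * Re a)) (1 / (2 * sqrt (Re a))) x" for x
    using gauss_density[OF a] one by (simp add: \<psi>)
  have "l2_inner \<psi> (position \<psi>) = 0" "l2_inner \<psi> (momentum \<psi>) = 0"
    using cen by (auto simp: centered_def forall_2 quad_def)
  then have "complex_of_real (Re b / (2 * Re a)) = 0"
    "- \<i> * b + 2 * \<i> * a * of_real (Re b / (2 * Re a)) = 0"
    using density_inner_linear[OF \<sigma> dens, of 0 1] density_inner_linear[OF \<sigma> dens, of "- \<i> * b" "2 * \<i> * a"]
    unfolding \<psi> momentum_gauss by (simp_all add: position_def)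
  \<comment> \<open>Zero mean position removes the second summand of the mean momentum, and what is
    left is \<open>- \<i> * b\<close>.\<close>
  then have "b = 0" by (simp only: mult_zero_right add_0_right) simp
  then have "\<psi> = gauss a c" by (simp add: \<psi> gauss_def fun_eq_iff)
  with a one S that show ?thesis using state_covar_gauss by metis
qed

lemma gauss_same_ray:
  assumes "Re a > 0" "l2_norm (gauss a c) = 1" "l2_norm (gauss a c') = 1"
  shows "\<exists>\<theta>. cmod \<theta> = 1 \<and> gauss a c = (\<lambda>x. \<theta> * gauss a c' x)"
proof (intro exI conjI)
  have eq: "gauss a c = (\<lambda>x. exp (c - c') * gauss a c' x)"
    by (simp add: gauss_def fun_eq_iff flip: exp_add)
  then show "gauss a c = (\<lambda>x. exp (c - c') * gauss a c' x)" .
  show "cmod (exp (c - c')) = 1"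
    using arg_cong[OF eq, of l2_norm] assms by (simp only: l2_norm_cmult)
qed

text \<open>The perturbed wave function is the original one times \<open>exp z\<close> with
  \<open>z = dC - dA x^2\<close>, so differentiability in the mean reduces to a pointwise Taylor
  estimate. The growth of \<open>exp z\<close> in \<open>x\<close> is absorbed by giving up half of
  the Gaussian decay, after which a single square-integrable majorant serves all small
  \<open>h\<close>.\<close>

lemma gauss_l2_partials:
  fixes A C :: "real \<times> real \<Rightarrow> complex"
  assumes A: "(A has_derivative (\<lambda>h. of_real (fst h) * a1 + of_real (snd h) * a2)) (at (r, \<phi>))"
    and C: "(C has_derivative (\<lambda>h. of_real (fst h) * c1 + of_real (snd h) * c2)) (at (r, \<phi>))"
    and pos: "\<And>p. Re (A p) > 0"
  shows "has_l2_partials (\<lambda>r \<phi>. gauss (A (r, \<phi>)) (C (r, \<phi>)))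
    (\<lambda>x. (c1 + (- a1) * of_real (x\<^sup>2)) * gauss (A (r, \<phi>)) (C (r, \<phi>)) x)
    (\<lambda>x. (c2 + (- a2) * of_real (x\<^sup>2)) * gauss (A (r, \<phi>)) (C (r, \<phi>)) x) r \<phi>"
proof -
  define p where "p = (r, \<phi>)"
  define a c where "a = A p" and "c = C p"
  define \<psi> where "\<psi> = gauss a c"
  define dA dC where "dA h = A (p + h) - a" and "dC h = C (p + h) - c" for h
  define rA rC where "rA h = dA h - (of_real (fst h) * a1 + of_real (snd h) * a2)"
    and "rC h = dC h - (of_real (fst h) * c1 + of_real (snd h) * c2)" for h
  define \<delta> \<rho> where "\<delta> h = cmod (dA h) + cmod (dC h)" and "\<rho> h = cmod (rA h) + cmod (rC h)" for h
  define e where "e h = (\<lambda>x. gauss (A (p + h)) (C (p + h)) x - \<psi> x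
      - of_real (fst h) * ((c1 + (- a1) * of_real (x\<^sup>2)) * \<psi> x)
      - of_real (snd h) * ((c2 + (- a2) * of_real (x\<^sup>2)) * \<psi> x))" for h
  \<comment> \<open>The majorant: halving the coefficient pays for \<open>exp (cmod z)\<close>, and
    \<open>(1 + x^2)^2\<close> pays for the square of \<open>cmod z\<close>.\<close>
  define W where "W = (\<lambda>x. of_real ((1 + x\<^sup>2)\<^sup>2) * gauss (a / 2) c x)"
  have a: "Re a > 0" unfolding a_def by (rule pos)
  have uv: "L2 (\<lambda>x. (q + q' * of_real (x\<^sup>2)) * \<psi> x)" for q q'
    unfolding \<psi>_def by (rule L2_gauss_quadratic[OF a])
  have e: "L2 (e h)" for h
    unfolding e_def using a pos by (intro L2_diff L2_cmult uv L2_gauss) (auto simp: \<psi>_def L2_gauss)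
  have W: "L2 W"
  proof -
    have a2: "Re (a / 2) > 0" using a by simp
    have "L2 (\<lambda>x. of_real (x ^ 0) * gauss (a / 2) c x + 2 * (of_real (x ^ 2) * gauss (a / 2) c x)
      + of_real (x ^ 4) * gauss (a / 2) c x)"
      by (intro L2_add L2_cmult L2_gauss_monomial a2)
    then show ?thesis unfolding W_def by (simp add: algebra_simps power2_eq_square power4_eq_xxxx)
  qed
  \<comment> \<open>The threshold 1 on \<open>\<delta> h\<close> produces the constant
    \<open>exp 1\<close>; the threshold \<open>Re a / 2\<close> limits the growth in
    \<open>x\<close> to the half of the decay that \<open>W\<close> gives up.\<close>
  have bound: "cmod (e h x) \<le> (exp 1 * (\<delta> h)\<^sup>2 + \<rho> h) * cmod (W x)"
    if small: "\<delta> h \<le> 1" "\<delta> h \<le> Re a / 2" for h x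
  proof -
    define z where "z = dC h - dA h * of_real (x\<^sup>2)"
    have d0: "\<delta> h \<ge> 0" "\<rho> h \<ge> 0" by (simp_all add: \<delta>_def \<rho>_def)
    have "gauss (A (p + h)) (C (p + h)) x = \<psi> x * exp z"
      unfolding \<psi>_def gauss_def z_def dA_def dC_def by (simp add: algebra_simps flip: exp_add)
    \<comment> \<open>The error separates into the second-order remainder of the exponential, of
      size \<open>(\<delta> h)^2\<close>, and the first-order remainders of \<open>A\<close> and
      \<open>C\<close>, of size \<open>\<rho> h\<close>.\<close>
    then have split: "e h x = \<psi> x * (exp z - 1 - z) + \<psi> x * (rC h - rA h * of_real (x\<^sup>2))"
      unfolding e_def z_def rA_def rC_def by (simp add: algebra_simps)
    have lin: "cmod (s - t * of_real (x\<^sup>2)) \<le> (cmod t + cmod s) * (1 + x\<^sup>2)" for s t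
    proof -
      have "cmod (s - t * of_real (x\<^sup>2)) \<le> cmod s + cmod t * x\<^sup>2"
        using norm_triangle_ineq4[of s "t * of_real (x\<^sup>2)"] by (simp add: norm_mult norm_power)
      also have "\<dots> \<le> (cmod t + cmod s) * (1 + x\<^sup>2)" by (simp add: algebra_simps)
      finally show ?thesis .
    qed
    have z: "cmod z \<le> \<delta> h * (1 + x\<^sup>2)" unfolding z_def \<delta>_def by (rule lin)
    have expz: "exp (cmod z) \<le> exp 1 * exp (Re a / 2 * x\<^sup>2)"
    proof -
      have "cmod z \<le> \<delta> h + \<delta> h * x\<^sup>2" using z by (simp add: algebra_simps)
      also have "\<dots> \<le> 1 + Re a / 2 * x\<^sup>2" using small by (intro add_mono mult_right_mono) auto
      finally show ?thesis by (simp flip: exp_add)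
    qed
    have "cmod (exp z - 1 - z) \<le> exp (cmod z) * (cmod z)\<^sup>2"
      using Taylor_exp_field[of z 1] by (simp add: diff_diff_eq power2_eq_square)
    also have "\<dots> \<le> (exp 1 * exp (Re a / 2 * x\<^sup>2)) * (\<delta> h * (1 + x\<^sup>2))\<^sup>2"
      using expz z by (intro mult_mono power_mono) auto
    finally have t1: "cmod (exp z - 1 - z) \<le> (exp 1 * (\<delta> h)\<^sup>2) * (exp (Re a / 2 * x\<^sup>2) * (1 + x\<^sup>2)\<^sup>2)"
      by (simp only: power_mult_distrib mult_ac)
    have "cmod (rC h - rA h * of_real (x\<^sup>2)) \<le> \<rho> h * (1 + x\<^sup>2)"
      unfolding \<rho>_def by (rule lin)
    also have "\<dots> \<le> \<rho> h * (exp (Re a / 2 * x\<^sup>2) * (1 + x\<^sup>2)\<^sup>2)"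
    proof (intro mult_left_mono)
      have "1 * (1 + x\<^sup>2) \<le> exp (Re a / 2 * x\<^sup>2) * (1 + x\<^sup>2)\<^sup>2"
        using a by (intro mult_mono self_le_power) auto
      then show "1 + x\<^sup>2 \<le> exp (Re a / 2 * x\<^sup>2) * (1 + x\<^sup>2)\<^sup>2" by simp
    qed (rule d0)
    finally have t2: "cmod (rC h - rA h * of_real (x\<^sup>2)) \<le> \<rho> h * (exp (Re a / 2 * x\<^sup>2) * (1 + x\<^sup>2)\<^sup>2)" .
    have "cmod (e h x) \<le> cmod (\<psi> x) * cmod (exp z - 1 - z) + cmod (\<psi> x) * cmod (rC h - rA h * of_real (x\<^sup>2))"
      unfolding split by (metis norm_triangle_ineq norm_mult)
    also have "\<dots> \<le> cmod (\<psi> x) * ((exp 1 * (\<delta> h)\<^sup>2) * (exp (Re a / 2 * x\<^sup>2) * (1 + x\<^sup>2)\<^sup>2))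
        + cmod (\<psi> x) * (\<rho> h * (exp (Re a / 2 * x\<^sup>2) * (1 + x\<^sup>2)\<^sup>2))"
      by (intro add_mono mult_left_mono t1 t2) auto
    also have "\<dots> = (exp 1 * (\<delta> h)\<^sup>2 + \<rho> h) * ((1 + x\<^sup>2)\<^sup>2 * (cmod (\<psi> x) * exp (Re a / 2 * x\<^sup>2)))"
      by (simp only: distrib_left distrib_right mult_ac)
    also have "cmod (\<psi> x) * exp (Re a / 2 * x\<^sup>2) = cmod (gauss (a / 2) c x)"
      by (simp add: \<psi>_def gauss_def field_simps flip: exp_add of_real_power)
    also have "(1 + x\<^sup>2)\<^sup>2 * cmod (gauss (a / 2) c x) = cmod (W x)"
      unfolding W_def norm_mult norm_of_real by simp
    finally show ?thesis .
  qed
  have lim_r: "((\<lambda>h. \<rho> h / norm h) \<longlongrightarrow> 0) (at 0)"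
  proof -
    have "((\<lambda>h. norm (rA h) / norm h) \<longlongrightarrow> 0) (at 0)" "((\<lambda>h. norm (rC h) / norm h) \<longlongrightarrow> 0) (at 0)"
      using A C unfolding has_derivative_at p_def[symmetric] rA_def rC_def dA_def dC_def a_def c_def
      by (simp_all add: scaleR_conv_of_real)
    from tendsto_add[OF this] show ?thesis by (simp add: \<rho>_def add_divide_distrib)
  qed
  have lim_\<delta>: "(\<delta> \<longlongrightarrow> 0) (at 0)"
  proof -
    have "((\<lambda>h. A (p + h)) \<longlongrightarrow> A p) (at 0)" "((\<lambda>h. C (p + h)) \<longlongrightarrow> C p) (at 0)"
      using has_derivative_continuous[OF A] has_derivative_continuous[OF C]
      unfolding p_def by (auto simp: isCont_iff)
    then have "((\<lambda>h. cmod (A (p + h) - A p) + cmod (C (p + h) - C p)) \<longlongrightarrow> cmod (A p - A p) + cmod (C p - C p)) (at 0)"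
      by (intro tendsto_intros)
    then show ?thesis unfolding \<delta>_def[abs_def] dA_def dC_def a_def c_def by simp
  qed
  define M where "M = cmod a1 + cmod a2 + cmod c1 + cmod c2"
  \<comment> \<open>The increments are at most linear in \<open>norm h\<close> up to the remainder.
    Hence \<open>(\<delta> h)^2 / norm h\<close> is bounded by \<open>\<delta> h\<close> times a
    quantity tending to \<open>M\<close>, and it vanishes in the limit.\<close>
  have \<delta>_le: "\<delta> h / norm h \<le> \<rho> h / norm h + M" if "h \<noteq> 0" for h
  proof -
    have fs: "\<bar>fst h\<bar> \<le> norm h" "\<bar>snd h\<bar> \<le> norm h"
      using norm_fst_le[of "fst h" "snd h"] norm_snd_le[of "snd h" "fst h"] by auto
    have lin: "cmod (of_real (fst h) * s + of_real (snd h) * t) \<le> norm h * (cmod s + cmod t)" for s t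
    proof -
      have "cmod (of_real (fst h) * s + of_real (snd h) * t) \<le> \<bar>fst h\<bar> * cmod s + \<bar>snd h\<bar> * cmod t"
        using norm_triangle_ineq[of "of_real (fst h) * s" "of_real (snd h) * t"] by (simp add: norm_mult)
      also have "\<dots> \<le> norm h * cmod s + norm h * cmod t"
        by (intro add_mono mult_right_mono fs) auto
      finally show ?thesis by (simp add: algebra_simps)
    qed
    have "cmod (dA h) \<le> cmod (rA h) + norm h * (cmod a1 + cmod a2)"
      using norm_triangle_ineq[of "rA h" "of_real (fst h) * a1 + of_real (snd h) * a2"] lin[of a1 a2]
      by (simp add: rA_def)
    moreover have "cmod (dC h) \<le> cmod (rC h) + norm h * (cmod c1 + cmod c2)"
      using norm_triangle_ineq[of "rC h" "of_real (fst h) * c1 + of_real (snd h) * c2"] lin[of c1 c2]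
      by (simp add: rC_def)
    ultimately have "\<delta> h \<le> \<rho> h + norm h * M"
      by (simp add: \<delta>_def \<rho>_def M_def algebra_simps)
    then show ?thesis using that by (simp add: field_simps)
  qed
  have "((\<lambda>h. exp 1 * (\<delta> h * (\<rho> h / norm h + M)) + \<rho> h / norm h) \<longlongrightarrow> exp 1 * (0 * (0 + M)) + 0) (at 0)"
    by (intro tendsto_intros lim_\<delta> lim_r)
  then have "((\<lambda>h. (exp 1 * (\<delta> h * (\<rho> h / norm h + M)) + \<rho> h / norm h) * l2_norm W) \<longlongrightarrow> 0) (at 0)"
    using tendsto_mult_left_zero by fastforce
  moreover have "eventually (\<lambda>h. norm (l2_norm (e h) / norm h)
      \<le> (exp 1 * (\<delta> h * (\<rho> h / norm h + M)) + \<rho> h / norm h) * l2_norm W) (at 0)"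
  proof -
    have "eventually (\<lambda>h. \<delta> h < min 1 (Re a / 2)) (at 0)"
      using lim_\<delta> a by (intro order_tendstoD) auto
    moreover have "eventually (\<lambda>h::real \<times> real. h \<noteq> 0) (at 0)" by (simp add: eventually_at_filter)
    ultimately show ?thesis
    proof eventually_elim
      case (elim h)
      have d0: "\<delta> h \<ge> 0" "\<rho> h \<ge> 0" by (simp_all add: \<delta>_def \<rho>_def)
      have "l2_norm (e h) \<le> (exp 1 * (\<delta> h)\<^sup>2 + \<rho> h) * l2_norm W"
        using elim d0 by (intro l2_norm_scaled_mono e W bound) auto
      then have "l2_norm (e h) / norm h \<le> (exp 1 * (\<delta> h)\<^sup>2 + \<rho> h) * l2_norm W / norm h"
        by (rule divide_right_mono) simp
      also have "\<dots> = (exp 1 * (\<delta> h * (\<delta> h / norm h)) + \<rho> h / norm h) * l2_norm W"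
        by (simp add: add_divide_distrib power2_eq_square algebra_simps)
      also have "\<dots> \<le> (exp 1 * (\<delta> h * (\<rho> h / norm h + M)) + \<rho> h / norm h) * l2_norm W"
        using \<delta>_le[of h] elim d0 by (intro mult_right_mono add_right_mono mult_left_mono) auto
      finally show ?case by simp
    qed
  qed
  ultimately have "((\<lambda>h. l2_norm (e h) / norm h) \<longlongrightarrow> 0) (at 0)"
    by (rule Lim_null_comparison[rotated])
  moreover have "(r, \<phi>) + h = (r + fst h, \<phi> + snd h)" for h
    by (simp add: plus_prod_def)
  ultimately show ?thesis
    unfolding has_l2_partials_def using uv
    by (simp only: e_def \<psi>_def a_def c_def p_def)
qed

text \<open>The real logarithm of the normalising factor \<open>(2 Re a / pi)^(1/4)\<close>.
  Choosing it real fixes the phase: the wave function is positive at the origin.\<close>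

definition lognorm :: "complex \<Rightarrow> complex" where
  "lognorm a = of_real (ln (2 * Re a / pi) / 4)"

lemma l2_norm_gauss_lognorm:
  assumes a: "Re a > 0"
  shows "l2_norm (gauss a (lognorm a)) = 1"
proof -
  define \<sigma> where "\<sigma> = 1 / (2 * sqrt (Re a))"
  have \<sigma>: "\<sigma> > 0" and \<sigma>2: "\<sigma>\<^sup>2 = 1 / (4 * Re a)"
    using a by (auto simp: \<sigma>_def power_divide power_mult_distrib)
  obtain K where K: "\<And>x. (cmod (exp (- a * (of_real x)\<^sup>2 + 0 * of_real x + lognorm a)))\<^sup>2
      = K * normal_density (Re 0 / (2 * Re a)) (1 / (2 * sqrt (Re a))) x"
    using cmod_exp_quadratic[OF a, where b = 0 and c = "lognorm a"] by metis
  have dens: "(cmod (gauss a (lognorm a) x))\<^sup>2 = K * normal_density 0 \<sigma> x" for x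
    using K[of x] by (simp add: gauss_def \<sigma>_def)
  \<comment> \<open>Evaluating the squared modulus and the normal density at 0 identifies
    \<open>K\<close>.\<close>
  have "sqrt (2 * Re a / pi) = exp (ln (2 * Re a / pi) / 2)"
    using a by (subst ln_sqrt[symmetric]) auto
  also have "\<dots> = K * normal_density 0 \<sigma> 0"
    using dens[of 0] by (simp add: gauss_def lognorm_def flip: exp_double)
  also have "normal_density 0 \<sigma> 0 = sqrt (2 * Re a / pi)"
    unfolding normal_density_def \<sigma>2 using a by (simp add: real_sqrt_divide field_simps)
  finally have "K = 1" using a by simp
  with dens show ?thesis by (intro density_l2_norm[OF \<sigma>]) simp
qed

text \<open>The form is the covariance of the two polynomial factors under the normal law. The
  constants \<open>p\<close> and \<open>p'\<close> cancel, and the variance of \<open>x^2\<close> is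
  \<open>3 \<sigma>^4 - \<sigma>^4\<close>, that is \<open>1 / (8 (Re a)^2)\<close>.\<close>

lemma fubini_study_gauss:
  assumes a: "Re a > 0" and one: "l2_norm (gauss a c) = 1"
  shows "fubini_study (gauss a c) (\<lambda>x. (p + q * of_real (x\<^sup>2)) * gauss a c x)
      (\<lambda>x. (p' + q' * of_real (x\<^sup>2)) * gauss a c x) = Re (cnj q * q') / (8 * (Re a)\<^sup>2)"
proof -
  define \<sigma> where "\<sigma> = 1 / (2 * sqrt (Re a))"
  have \<sigma>: "\<sigma> > 0" and \<sigma>2: "\<sigma>\<^sup>2 = 1 / (4 * Re a)"
    using a by (auto simp: \<sigma>_def power_divide power_mult_distrib)
  have dens: "(cmod (gauss a c x))\<^sup>2 = normal_density 0 \<sigma> x" for x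
    using gauss_density[of a 0 c x] a one by (simp add: gauss_def[abs_def] \<sigma>_def)
  note inner = density_inner_quadratic[OF \<sigma> dens]
  have "l2_inner (\<lambda>x. (p + q * of_real (x\<^sup>2)) * gauss a c x) (\<lambda>x. (p' + q' * of_real (x\<^sup>2)) * gauss a c x)
      - l2_inner (\<lambda>x. (p + q * of_real (x\<^sup>2)) * gauss a c x) (gauss a c)
        * l2_inner (gauss a c) (\<lambda>x. (p' + q' * of_real (x\<^sup>2)) * gauss a c x)
    = cnj q * q' * of_real (2 * (\<sigma>\<^sup>2)\<^sup>2)"
    using inner[of p q p' q'] inner[of p q 1 0] inner[of 1 0 p' q']
    by (simp add: algebra_simps power2_eq_square power4_eq_xxxx)
  then show ?thesis
    unfolding fubini_study_def \<sigma>2 by (simp add: power2_eq_square)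
qed

section \<open>Lifts of the pure Gaussian states\<close>

definition width :: "real \<Rightarrow> real \<Rightarrow> complex" where
  "width r \<phi> = of_real (1 / (2 * Gxx r \<phi>)) - \<i> * of_real (Gxp r \<phi> / (2 * Gxx r \<phi>))"

definition dwidth :: "coord \<Rightarrow> real \<Rightarrow> real \<Rightarrow> complex" where
  "dwidth i r \<phi> = of_real (- dGxx i r \<phi> / (2 * (Gxx r \<phi>)\<^sup>2))
     - \<i> * of_real ((Gxx r \<phi> * dGxp i r \<phi> - Gxp r \<phi> * dGxx i r \<phi>) / (2 * (Gxx r \<phi>)\<^sup>2))"

lemma Re_width [simp]: "Re (width r \<phi>) = 1 / (2 * Gxx r \<phi>)"
  by (simp add: width_def)

lemma Im_width [simp]: "Im (width r \<phi>) = - Gxp r \<phi> / (2 * Gxx r \<phi>)"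
  by (simp add: width_def)

text \<open>Two entries fix the real and imaginary parts of the coefficient. The third then agrees
  because G has determinant 1, which expresses the purity of the state.\<close>

lemma squeeze_width:
  "(1/2) *\<^sub>R squeeze r \<phi> = sym2 (1 / (4 * Re (width r \<phi>)))
     (- Im (width r \<phi>) / (2 * Re (width r \<phi>))) ((cmod (width r \<phi>))\<^sup>2 / Re (width r \<phi>))"
proof -
  have "(cmod (width r \<phi>))\<^sup>2 / Re (width r \<phi>) = (1 + (Gxp r \<phi>)\<^sup>2) / (2 * Gxx r \<phi>)"
    unfolding cmod_power2 by (simp add: field_simps power2_eq_square)
  also have "\<dots> = Gpp r \<phi> / 2"
    using Gdet[of r \<phi>] by (simp add: field_simps)
  finally show ?thesis by (simp add: squeeze_eq mat2_eq_iff)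
qed

lemma width_has_derivative:
  "((\<lambda>p. width (fst p) (snd p)) has_derivative
     (\<lambda>h. of_real (fst h) * dwidth Sq r \<phi> + of_real (snd h) * dwidth Ph r \<phi>)) (at (r, \<phi>))"
proof -
  have 1: "((\<lambda>p. 1 / (2 * f p)) has_derivative (\<lambda>h. - f' h / (2 * (f p)\<^sup>2))) (at p)"
    and 2: "((\<lambda>p. g p / (2 * f p)) has_derivative (\<lambda>h. (f p * g' h - g p * f' h) / (2 * (f p)\<^sup>2))) (at p)"
    if "(f has_derivative f') (at p)" "(g has_derivative g') (at p)" "f p \<noteq> 0"
    for f g f' g' :: "real \<times> real \<Rightarrow> real" and p
    by (rule has_derivative_eq_rhs, (rule derivative_intros that)+,
        use that in \<open>auto simp: fun_eq_iff field_simps power2_eq_square\<close>)+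
  have x: "Gxx (fst (r, \<phi>)) (snd (r, \<phi>)) \<noteq> 0" by simp
  show ?thesis
    unfolding width_def
    by (rule has_derivative_eq_rhs, (rule has_derivative_diff has_derivative_mult_right
          has_derivative_of_real 1[OF G_has_derivative(1,2) x] 2[OF G_has_derivative(1,2) x])+)
      (simp add: fun_eq_iff dwidth_def complex_eq_iff add_divide_distrib diff_divide_distrib algebra_simps)
qed

lemma lognorm_width_has_derivative:
  "((\<lambda>p. lognorm (width (fst p) (snd p))) has_derivative
     (\<lambda>h. of_real (fst h) * of_real (- dGxx Sq r \<phi> / (4 * Gxx r \<phi>))
        + of_real (snd h) * of_real (- dGxx Ph r \<phi> / (4 * Gxx r \<phi>)))) (at (r, \<phi>))"
proof -
  have 1: "((\<lambda>p. - ln (pi * f p) / 4) has_derivative (\<lambda>h. - f' h / (4 * f p))) (at p)"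
    if "(f has_derivative f') (at p)" "f p > 0" for f f' :: "real \<times> real \<Rightarrow> real" and p
  proof -
    have "((\<lambda>p. ln (pi * f p)) has_derivative (\<lambda>h. pi * f' h * inverse (pi * f p))) (at p)"
      using that by (intro has_derivative_ln has_derivative_mult_right) simp_all
    from has_derivative_mult_right[OF this, of "- 1/4"] show ?thesis
      using that by (simp add: field_simps)
  qed
  have x: "Gxx (fst (r, \<phi>)) (snd (r, \<phi>)) > 0" by simp
  \<comment> \<open>Since \<open>Re (width r \<phi>) = 1 / (2 Gxx)\<close>, the argument of the
    logarithm is \<open>1 / (pi Gxx)\<close>.\<close>
  have eq: "lognorm (width (fst p) (snd p)) = of_real (- ln (pi * Gxx (fst p) (snd p)) / 4)" for p
    by (simp add: lognorm_def ln_div ln_mult)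
  show ?thesis
    unfolding eq
    by (rule has_derivative_eq_rhs, rule has_derivative_of_real, rule 1[OF G_has_derivative(1) x])
      (simp add: fun_eq_iff complex_eq_iff field_simps del: dGxx.simps)
qed

text \<open>The right-hand side is one eighth of the hyperbolic metric of the half-plane
  \<open>Re a > 0\<close>, pulled back along \<open>width\<close>. The determinant constraint and
  its derivative eliminate \<open>Gpp\<close> and \<open>dGpp\<close>, leaving a rational identity
  in the other two entries.\<close>

lemma bures_limit_width:
  "bures_limit i j r \<phi> = Re (cnj (dwidth i r \<phi>) * dwidth j r \<phi>) / (8 * (Re (width r \<phi>))\<^sup>2)"
proof -
  define x y z where "x = Gxx r \<phi>" and "y = Gxp r \<phi>" and "z = Gpp r \<phi>"
  have x: "x \<noteq> 0" unfolding x_def by simp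
  have dz: "dGpp k r \<phi> = 2 * y * dGxp k r \<phi> / x - (1 + y\<^sup>2) * dGxx k r \<phi> / x\<^sup>2" for k
  proof -
    have "z = (1 + y\<^sup>2) / x" using Gdet[of r \<phi>] x by (simp add: x_def y_def z_def field_simps)
    moreover have "dGpp k r \<phi> = (2 * y * dGxp k r \<phi> - dGxx k r \<phi> * z) / x"
      using dGdet[of k r \<phi>] x by (simp add: x_def y_def z_def field_simps)
    ultimately have "dGpp k r \<phi> = (2 * y * dGxp k r \<phi> - dGxx k r \<phi> * ((1 + y\<^sup>2) / x)) / x"
      by simp
    also have "\<dots> = 2 * y * dGxp k r \<phi> / x - (1 + y\<^sup>2) * dGxx k r \<phi> / x\<^sup>2"
      using x by (simp add: field_simps power2_eq_square)
    finally show ?thesis .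
  qed
  show ?thesis
    unfolding bures_limit_def dwidth_def dz Re_width x_def[symmetric] y_def[symmetric]
    using x by (simp add: field_simps power2_eq_square)
qed

definition gauss_lift :: "real \<Rightarrow> real \<Rightarrow> real \<Rightarrow> complex" where
  "gauss_lift r \<phi> = gauss (width r \<phi>) (lognorm (width r \<phi>))"

lemma gaussian_lift_gauss_lift: "gaussian_lift gauss_lift"
  unfolding gaussian_lift_def squeeze_width gauss_lift_def
  by (intro allI pure_gaussian_gauss l2_norm_gauss_lognorm) simp_all

text \<open>The first coefficient is the derivative of \<open>lognorm\<close> along the family and
  the coefficient of \<open>x^2\<close> is minus that of \<open>width\<close>, so the vector has the
  shape required by \<open>fubini_study_gauss\<close>.\<close>

definition gauss_tangent :: "coord \<Rightarrow> real \<Rightarrow> real \<Rightarrow> real \<Rightarrow> complex" where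
  "gauss_tangent i r \<phi> x =
     (of_real (- dGxx i r \<phi> / (4 * Gxx r \<phi>)) + (- dwidth i r \<phi>) * of_real (x\<^sup>2)) * gauss_lift r \<phi> x"

lemma gauss_lift_l2_partials:
  "has_l2_partials gauss_lift (gauss_tangent Sq r \<phi>) (gauss_tangent Ph r \<phi>) r \<phi>"
proof -
  have "Re (width (fst p) (snd p)) > 0" for p by simp
  from gauss_l2_partials[OF width_has_derivative[of r \<phi>] lognorm_width_has_derivative[of r \<phi>] this]
  show ?thesis
    unfolding gauss_tangent_def[abs_def] gauss_lift_def[abs_def] fst_conv snd_conv .
qed

lemma fubini_study_gauss_lift:
  "fubini_study (gauss_lift r \<phi>) (gauss_tangent i r \<phi>) (gauss_tangent j r \<phi>) = bures_limit i j r \<phi>"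
  unfolding bures_limit_width gauss_tangent_def[abs_def] gauss_lift_def
  by (subst fubini_study_gauss) (simp_all add: l2_norm_gauss_lognorm)

text \<open>The first row of the covariance determines \<open>a\<close>, and unit norm then
  determines the wave function up to a phase.\<close>

lemma gaussian_lift_ray:
  assumes "gaussian_lift \<psi>"
  shows "\<exists>\<theta>. cmod \<theta> = 1 \<and> \<psi> r \<phi> = (\<lambda>x. \<theta> * gauss_lift r \<phi> x)"
proof -
  obtain a c where a: "Re a > 0" "\<psi> r \<phi> = gauss a c" "l2_norm (\<psi> r \<phi>) = 1"
    and S: "(1/2) *\<^sub>R squeeze r \<phi> = sym2 (1 / (4 * Re a)) (- Im a / (2 * Re a)) ((cmod a)\<^sup>2 / Re a)"
    using assms pure_gaussianE unfolding gaussian_lift_def by metis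
  have "Gxx r \<phi> = 1 / (2 * Re a)" "Gxp r \<phi> = - Im a / Re a"
    using S by (auto simp: squeeze_eq mat2_eq_iff)
  then have "Re a = Re (width r \<phi>)" "Im a = Im (width r \<phi>)"
    using a(1) by simp_all
  then have "a = width r \<phi>" by (rule complex_eqI)
  with a show ?thesis
    unfolding gauss_lift_def by (metis gauss_same_ray l2_norm_gauss_lognorm)
qed

lemma gaussian_lift_unit:
  assumes "gaussian_lift \<psi>"
  shows "L2 (\<psi> r \<phi>)" "l2_norm (\<psi> r \<phi>) = 1"
proof -
  obtain a c where "Re a > 0" "\<psi> r \<phi> = gauss a c" "l2_norm (\<psi> r \<phi>) = 1"
    using assms pure_gaussianE unfolding gaussian_lift_def by metis
  then show "L2 (\<psi> r \<phi>)" "l2_norm (\<psi> r \<phi>) = 1" by (simp_all add: L2_gauss)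
qed

lemma fubini_study_gaussian_lift:
  assumes "gaussian_lift \<psi>" "has_l2_partials \<psi> u v r \<phi>"
  shows "fubini_study (\<psi> r \<phi>) u u = bures_limit Sq Sq r \<phi>"
    "fubini_study (\<psi> r \<phi>) u v = bures_limit Sq Ph r \<phi>"
    "fubini_study (\<psi> r \<phi>) v v = bures_limit Ph Ph r \<phi>"
  using fubini_study_ray[OF assms(2) gaussian_lift_unit[OF assms(1)] gauss_lift_l2_partials
      gaussian_lift_unit[OF gaussian_lift_gauss_lift] gaussian_lift_ray[OF assms(1)]]
  by (simp_all add: fubini_study_gauss_lift)

lemma bures_limit_commute: "bures_limit i j r \<phi> = bures_limit j i r \<phi>"
  by (simp add: bures_limit_def)

theorem theorem5:
  shows
    "(\<forall>r \<phi>. filterlim (\<lambda>\<nu>. bures Nu Nu \<nu> r \<phi>) at_top (at_right (1/2))) \<and>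
     (\<forall>i j r \<phi>. (i, j) \<noteq> (Nu, Nu) \<longrightarrow>
        (\<exists>L. ((\<lambda>\<nu>. bures i j \<nu> r \<phi>) \<longlongrightarrow> L) (at_right (1/2)))) \<and>
     (\<exists>\<psi> u v. gaussian_lift \<psi> \<and> (\<forall>r \<phi>. has_l2_partials \<psi> (u r \<phi>) (v r \<phi>) r \<phi>)) \<and>
     (\<forall>\<psi> u v r \<phi>. gaussian_lift \<psi> \<and> has_l2_partials \<psi> u v r \<phi> \<longrightarrow>
        ((\<lambda>\<nu>. bures Sq Sq \<nu> r \<phi>) \<longlongrightarrow> fubini_study (\<psi> r \<phi>) u u) (at_right (1/2)) \<and>
        ((\<lambda>\<nu>. bures Sq Ph \<nu> r \<phi>) \<longlongrightarrow> fubini_study (\<psi> r \<phi>) u v) (at_right (1/2)) \<and>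
        ((\<lambda>\<nu>. bures Ph Sq \<nu> r \<phi>) \<longlongrightarrow> fubini_study (\<psi> r \<phi>) v u) (at_right (1/2)) \<and>
        ((\<lambda>\<nu>. bures Ph Ph \<nu> r \<phi>) \<longlongrightarrow> fubini_study (\<psi> r \<phi>) v v) (at_right (1/2)))"
proof (intro conjI allI impI)
  \<comment> \<open>The explicit lift shows that the claim about all differentiable lifts is not
    vacuous.\<close>
  show "\<exists>\<psi> u v. gaussian_lift \<psi> \<and> (\<forall>r \<phi>. has_l2_partials \<psi> (u r \<phi>) (v r \<phi>) r \<phi>)"
    using gaussian_lift_gauss_lift gauss_lift_l2_partials by blast
next
  fix \<psi> u v r \<phi> assume *: "gaussian_lift \<psi> \<and> has_l2_partials \<psi> u v r \<phi>"
  note fs = fubini_study_gaussian_lift[OF conjunct1[OF *] conjunct2[OF *]]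
  show "((\<lambda>\<nu>. bures Sq Sq \<nu> r \<phi>) \<longlongrightarrow> fubini_study (\<psi> r \<phi>) u u) (at_right (1/2))"
    "((\<lambda>\<nu>. bures Sq Ph \<nu> r \<phi>) \<longlongrightarrow> fubini_study (\<psi> r \<phi>) u v) (at_right (1/2))"
    "((\<lambda>\<nu>. bures Ph Sq \<nu> r \<phi>) \<longlongrightarrow> fubini_study (\<psi> r \<phi>) v u) (at_right (1/2))"
    "((\<lambda>\<nu>. bures Ph Ph \<nu> r \<phi>) \<longlongrightarrow> fubini_study (\<psi> r \<phi>) v v) (at_right (1/2))"
    \<comment> \<open>Symmetry of the form reduces the \<open>Ph\<close>-\<open>Sq\<close> component
      to the \<open>Sq\<close>-\<open>Ph\<close> one, and \<open>bures_limit\<close> is symmetric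
      likewise.\<close>
    unfolding fubini_study_commute[of "\<psi> r \<phi>" v u] fs
    using tendsto_bures_tangent[of Ph Sq r \<phi>]
    by (simp_all add: tendsto_bures_tangent bures_limit_commute[of Ph Sq])
qed (simp_all add: filterlim_bures_Nu_Nu bures_convergent)

end
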